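(* Let $\mathscr{H}_1,\mathscr{H}_2$ be Hilbert spaces and $n\ge1$. For $1\le i\le n$ let $$\widetilde{S}_i=\begin{bmatrix}A_i&0\\ 0&B_i\end{bmatrix},\qquad \widetilde{T}_i=\begin{bmatrix}0&X_i\\ {Y_i}&0\end{bmatrix},\qquad \widetilde{U}_i=\begin{bmatrix}C_i&0\\ 0&D_i\end{bmatrix}$$ be operator matrices in $\mathbb{B}(\mathscr{H}_1\oplus\mathscr{H}_2)$ (so $A_i,C_i\in\mathbb{B}(\mathscr{H}_1)$, $B_i,D_i\in\mathbb{B}(\mathscr{H}_2)$, $X_i\in\mathbb{B}(\mathscr{H}_2,\mathscr{H}_1)$, $Y_i\in\mathbb{B}(\mathscr{H}_1,\mathscr{H}_2)$) such that $A_i,B_i,C_i,D_i$ are contractions. Let $f,g$ be nonnegative continuous functions on $[0,\infty)$ satisfying $f(t)g(t)=t$ for all $t\in[0,\infty)$, and let $p\ge1$. Then $$\omega_p^p(\widetilde{S}_1^*\widetilde{T}_1\widetilde{U}_1,\ldots,\widetilde{S}_n^*\widetilde{T}_n\widetilde{U}_n)\leq 2^{p-2}\sum_{i=1}^n\left\|D_i^*f^{2p}(|X_i|)D_i+B_i^*g^{2p}(|Y_i^*|)B_i\right\|^{\frac12}\left\|C_i^*f^{2p}(|Y_i|)C_i+A_i^*g^{2p}(|X_i^*|)A_i\right\|^{\frac12}$$ and $$\omega_p^p(\widetilde{S}_1^*\widetilde{T}_1\widetilde{U}_1,\ldots,\widetilde{S}_n^*\widetilde{T}_n\widetilde{U}_n)\leq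 2^{p-2}\sum_{i=1}^n\left\|D_i^*f^{2p}(|X_i|)D_i+B_i^*f^{2p}(|Y_i^*|)B_i\right\|^{\frac12}\left\|C_i^*g^{2p}(|Y_i|)C_i+A_i^*g^{2p}(|X_i^*|)A_i\right\|^{\frac12}.$$
   Context: Hilbert spaces are complex. $\mathbb{B}(\mathscr{K},\mathscr{L})$ is the space of bounded linear operators from $\mathscr{K}$ to $\mathscr{L}$, and $\mathbb{B}(\mathscr{K})=\mathbb{B}(\mathscr{K},\mathscr{K})$. An operator $A$ is a contraction if $A^*A\le I$. For $T_1,\ldots,T_n\in\mathbb{B}(\mathscr{K})$ and $p\ge1$, the generalized Euclidean operator radius is $\omega_p(T_1,\ldots,T_n)=\sup_{\|x\|=1}\left(\sum_{i=1}^n|\langle T_ix,x\rangle|^p\right)^{1/p}$, and $\omega_p^p$ denotes its $p$-th power. $|A|=(A^*A)^{1/2}$. $f^{2p}(A)$ denotes $h(A)$, with $h(t)=f(t)^{2p}$, in the continuous functional calculus of the positive operator $A$ (similarly $g^{2p}$). $\|\cdot\|$ is the operator norm. *)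

theory Defs
  imports "HOL-Analysis.Analysis"
begin

class complex_vector = real_vector +
  fixes scaleC :: "complex \<Rightarrow> 'a \<Rightarrow> 'a"  (infixr "*\<^sub>C" 75)
  assumes scaleC_add_right: "c *\<^sub>C (x + y) = c *\<^sub>C x + c *\<^sub>C y"
    and scaleC_add_left: "(c + d) *\<^sub>C x = c *\<^sub>C x + d *\<^sub>C x"
    and scaleC_scaleC: "c *\<^sub>C d *\<^sub>C x = (c * d) *\<^sub>C x"
    and scaleC_one: "1 *\<^sub>C x = x"
    and scaleR_eq_scaleC: "r *\<^sub>R x = complex_of_real r *\<^sub>C x"

text \<open>
  The complex inner product is linear in the first argument.  Basing the class on
  \<^class>\<open>real_inner\<close>, with real part of the complex inner product as the real one, provides
  positive definiteness and \<open>norm x = sqrt (Re (cinner x x))\<close>.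
\<close>

class complex_inner = complex_vector + real_inner +
  fixes cinner :: "'a \<Rightarrow> 'a \<Rightarrow> complex"
  assumes cinner_commute: "cinner x y = cnj (cinner y x)"
    and cinner_add_left: "cinner (x + y) z = cinner x z + cinner y z"
    and cinner_scaleC_left: "cinner (c *\<^sub>C x) y = c * cinner x y"
    and inner_eq_Re_cinner: "inner x y = Re (cinner x y)"

class chilbert_space = complex_inner + complete_space

text \<open>The Hilbert space direct sum of two spaces is their product type.\<close>

instantiation prod :: (complex_vector, complex_vector) complex_vector
begin

definition scaleC_prod_def: "c *\<^sub>C z = (c *\<^sub>C fst z, c *\<^sub>C snd z)"

instance
  by standard
    (simp_all add: scaleC_prod_def scaleC_add_right scaleC_add_left scaleC_scaleC scaleC_one
      scaleR_prod_def scaleR_eq_scaleC)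

end

instantiation prod :: (complex_inner, complex_inner) complex_inner
begin

definition cinner_prod_def: "cinner z w = cinner (fst z) (fst w) + cinner (snd z) (snd w)"

instance
proof
  fix x y z :: "'a \<times> 'b" and c :: complex
  show "cinner x y = cnj (cinner y x)"
    unfolding cinner_prod_def complex_cnj_add
    by (metis cinner_commute)
  show "cinner (x + y) z = cinner x z + cinner y z"
    by (simp add: cinner_prod_def cinner_add_left)
  show "cinner (c *\<^sub>C x) y = c * cinner x y"
    by (simp add: cinner_prod_def scaleC_prod_def cinner_scaleC_left distrib_left)
  show "inner x y = Re (cinner x y)"
    by (simp add: cinner_prod_def inner_prod_def inner_eq_Re_cinner)
qed

end

instance prod :: (chilbert_space, chilbert_space) chilbert_space ..

definition bounded_clinear :: "('a::complex_inner \<Rightarrow> 'b::complex_inner) \<Rightarrow> bool" where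
  "bounded_clinear T \<longleftrightarrow> bounded_linear T \<and> (\<forall>c x. T (c *\<^sub>C x) = c *\<^sub>C T x)"

definition cadjoint :: "('a::complex_inner \<Rightarrow> 'b::complex_inner) \<Rightarrow> 'b \<Rightarrow> 'a"
    ("_\<^sup>\<dagger>" [1000] 999) where
  "T\<^sup>\<dagger> = (THE R. \<forall>x y. cinner (T x) y = cinner x (R y))"

definition positive_op :: "('a::complex_inner \<Rightarrow> 'a) \<Rightarrow> bool" where
  "positive_op T \<longleftrightarrow>
     bounded_clinear T \<and> (\<forall>x. Im (cinner (T x) x) = 0 \<and> 0 \<le> Re (cinner (T x) x))"

definition op_le :: "('a::complex_inner \<Rightarrow> 'a) \<Rightarrow> ('a \<Rightarrow> 'a) \<Rightarrow> bool" where
  "op_le S T \<longleftrightarrow> positive_op (\<lambda>x. T x - S x)"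

definition contraction :: "('a::complex_inner \<Rightarrow> 'b::complex_inner) \<Rightarrow> bool" where
  "contraction T \<longleftrightarrow> bounded_clinear T \<and> op_le (T\<^sup>\<dagger> \<circ> T) id"

definition op_sqrt :: "('a::complex_inner \<Rightarrow> 'a) \<Rightarrow> 'a \<Rightarrow> 'a" where
  "op_sqrt T = (THE R. positive_op R \<and> R \<circ> R = T)"

definition op_abs :: "('a::complex_inner \<Rightarrow> 'b::complex_inner) \<Rightarrow> 'a \<Rightarrow> 'a" where
  "op_abs T = op_sqrt (T\<^sup>\<dagger> \<circ> T)"

definition op_spectrum :: "('a::complex_inner \<Rightarrow> 'a) \<Rightarrow> complex set" where
  "op_spectrum T = {z. \<not> (\<exists>R. bounded_clinear R \<and>
     R \<circ> (\<lambda>x. T x - z *\<^sub>C x) = id \<and> (\<lambda>x. T x - z *\<^sub>C x) \<circ> R = id)}"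

text \<open>
  \<open>Phi\<close> is a unital *-homomorphism from the continuous functions on the spectrum of \<open>T\<close> to the
  bounded operators that maps the identity function to \<open>T\<close>.  Elements of the function algebra are
  represented by total functions, so \<open>Phi\<close> is required to depend only on the values on the spectrum.
\<close>

definition is_functional_calculus ::
    "('a::complex_inner \<Rightarrow> 'a) \<Rightarrow> ((complex \<Rightarrow> complex) \<Rightarrow> 'a \<Rightarrow> 'a) \<Rightarrow> bool" where
  "is_functional_calculus T Phi \<longleftrightarrow>
     (let C = {h. continuous_on (op_spectrum T) h} in
       (\<forall>h\<in>C. bounded_clinear (Phi h)) \<and>
       (\<forall>h\<in>C. \<forall>k\<in>C. (\<forall>z\<in>op_spectrum T. h z = k z) \<longrightarrow> Phi h = Phi k) \<and>
       (\<forall>h\<in>C. \<forall>k\<in>C. Phi (\<lambda>z. h z + k z) = (\<lambda>x. Phi h x + Phi k x)) \<and>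
       (\<forall>c. \<forall>h\<in>C. Phi (\<lambda>z. c * h z) = (\<lambda>x. c *\<^sub>C Phi h x)) \<and>
       (\<forall>h\<in>C. \<forall>k\<in>C. Phi (\<lambda>z. h z * k z) = Phi h \<circ> Phi k) \<and>
       (\<forall>h\<in>C. Phi (\<lambda>z. cnj (h z)) = (Phi h)\<^sup>\<dagger>) \<and>
       Phi (\<lambda>_. 1) = id \<and>
       Phi (\<lambda>z. z) = T)"

text \<open>
  The operator \<open>h(T)\<close>, for a positive operator \<open>T\<close> and a real function \<open>h\<close> continuous
  on \<open>[0,\<infinity>)\<close>; the spectrum of \<open>T\<close> is then a set of nonnegative reals, on which \<open>z\<close> and
  \<open>Re z\<close> agree.
\<close>

definition op_fun :: "(real \<Rightarrow> real) \<Rightarrow> ('a::complex_inner \<Rightarrow> 'a) \<Rightarrow> 'a \<Rightarrow> 'a" where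
  "op_fun h T =
     (THE R. \<exists>Phi. is_functional_calculus T Phi \<and> R = Phi (\<lambda>z. complex_of_real (h (Re z))))"

definition op_matrix ::
    "('a::complex_inner \<Rightarrow> 'a) \<Rightarrow> ('b::complex_inner \<Rightarrow> 'a) \<Rightarrow> ('a \<Rightarrow> 'b) \<Rightarrow> ('b \<Rightarrow> 'b)
      \<Rightarrow> 'a \<times> 'b \<Rightarrow> 'a \<times> 'b" where
  "op_matrix P Q R S = (\<lambda>(x, y). (P x + Q y, R x + S y))"

text \<open>
  The supremum is taken in \<open>[0,\<infinity>)\<close>: inserting \<open>0\<close> has no effect unless the space is
  \<open>{0}\<close> and has no unit vectors, where it makes the radius \<open>0\<close>.
\<close>

definition euclidean_operator_radius ::
    "real \<Rightarrow> nat \<Rightarrow> (nat \<Rightarrow> 'a::complex_inner \<Rightarrow> 'a) \<Rightarrow> real" where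
  "euclidean_operator_radius p n T =
     Sup (insert 0 {(\<Sum>i=1..n. cmod (cinner (T i x) x) powr p) powr (1 / p) | x. norm x = 1})"

end

theory Submission
  imports Defs "HOL-Computational_Algebra.Fundamental_Theorem_Algebra"
begin

text \<open>
  Write a unit vector as \<open>z = (x, y)\<close>.  The \<open>i\<close>-th form \<open>\<langle>S\<^sup>* T U z, z\<rangle> = \<langle>T U z, S z\<rangle>\<close> is the sum of
  \<open>\<langle>X D y, A x\<rangle>\<close> and \<open>\<langle>Y C x, B y\<rangle>\<close>.  Each term is estimated by the mixed Schwarz inequality
  \<open>\<bar>\<langle>X u, v\<rangle>\<bar> \<le> \<parallel>f(\<bar>X\<bar>) u\<parallel> \<parallel>g(\<bar>X\<^sup>*\<bar>) v\<parallel>\<close> (\<open>mixed_schwarz\<close>) and raised to the power \<open>p\<close> with Jensen's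
  inequality \<open>\<langle>k(T) u, u\<rangle>\<^sup>p \<le> \<langle>k\<^sup>p(T) u, u\<rangle>\<close> for \<open>\<parallel>u\<parallel> \<le> 1\<close> (\<open>powr_cinner_op_fun_le\<close>); the contractions keep
  \<open>D y\<close>, \<open>A x\<close>, \<open>C x\<close> and \<open>B y\<close> in the unit ball.  Convexity of \<open>s\<^sup>p\<close> costs a factor \<open>2\<^sup>p\<^sup>-\<^sup>1\<close>, the
  Cauchy-Schwarz inequality in the plane collects the forms in \<open>y\<close> and the forms in \<open>x\<close> under one
  norm each, and \<open>\<parallel>x\<parallel> \<parallel>y\<parallel> \<le> 1/2\<close> gains the remaining \<open>1/2\<close> (\<open>off_diagonal_powr_le\<close>).  The two
  inequalities of the theorem differ only in the pair used for \<open>Y\<close>: \<open>(f, g)\<close> or \<open>(g, f)\<close>.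

  Adjoints, square roots and the functional calculus are given by definite descriptions, so their
  existence and uniqueness carry much of the proof.  Adjoints come from the Riesz representation
  theorem.  For a self-adjoint \<open>T\<close>, the bound \<open>\<parallel>q(T)\<parallel> \<le> sup \<bar>q\<bar>\<close> over the spectrum (\<open>norm_op_poly_le\<close>)
  follows from the factorization of polynomials and the fact that \<open>N\<^sup>2 - \<parallel>N\<parallel>\<^sup>2\<close> is not invertible for
  self-adjoint \<open>N\<close> on a nonzero space.  With Weierstrass approximation it yields the continuous functional calculus,
  which is unique because *-homomorphisms are contractive.  Uniqueness also gives the substitution rule
  \<open>h(R\<^sup>2) = (t \<mapsto> h(t\<^sup>2))(R)\<close> for positive \<open>R\<close> (\<open>op_fun_square\<close>), hence unique positive square roots and,
  from \<open>X (X\<^sup>* X) = (X X\<^sup>*) X\<close>, the relation \<open>X h(\<bar>X\<bar>) = h(\<bar>X\<^sup>*\<bar>) X\<close> on which the mixed Schwarz inequality rests.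
\<close>


section \<open>Complex inner product spaces\<close>

lemma cinner_add_right: "cinner x (y + z) = cinner x y + cinner x z"
  by (metis cinner_commute cinner_add_left complex_cnj_add)

lemma cinner_scaleC_right: "cinner x (c *\<^sub>C y) = cnj c * cinner x y"
  by (metis cinner_commute cinner_scaleC_left complex_cnj_mult)

lemma scaleC_zero_right [simp]: "c *\<^sub>C (0::'a::complex_vector) = 0"
  using scaleC_add_right[of c "0::'a" 0] by simp

lemma scaleC_zero_left [simp]: "0 *\<^sub>C (x::'a::complex_vector) = 0"
  using scaleC_add_left[of 0 0 x] by simp

lemma scaleC_minus_left: "(- c) *\<^sub>C x = - (c *\<^sub>C (x::'a::complex_vector))"
  using scaleC_add_left[of "-c" c x] by (simp add: eq_neg_iff_add_eq_0)

lemma scaleC_minus_right: "c *\<^sub>C (- x) = - (c *\<^sub>C (x::'a::complex_vector))"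
  using scaleC_add_right[of c "-x" x] by (simp add: eq_neg_iff_add_eq_0)

lemma scaleC_diff_left: "(c - d) *\<^sub>C x = c *\<^sub>C x - d *\<^sub>C (x::'a::complex_vector)"
  using scaleC_add_left[of c "-d" x] by (simp add: scaleC_minus_left)

lemma scaleC_diff_right: "c *\<^sub>C (x - y) = c *\<^sub>C x - c *\<^sub>C (y::'a::complex_vector)"
  using scaleC_add_right[of c x "-y"] by (simp add: scaleC_minus_right)

lemma cinner_zero_left [simp]: "cinner 0 x = 0"
  using cinner_add_left[of 0 0 x] by simp

lemma cinner_zero_right [simp]: "cinner x 0 = 0"
  using cinner_add_right[of x 0 0] by simp

lemma cinner_minus_left: "cinner (- x) y = - cinner x y"
  using cinner_add_left[of "-x" x y] by (simp add: eq_neg_iff_add_eq_0)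

lemma cinner_minus_right: "cinner x (- y) = - cinner x y"
  using cinner_add_right[of x "-y" y] by (simp add: eq_neg_iff_add_eq_0)

lemma cinner_diff_left: "cinner (x - y) z = cinner x z - cinner y z"
  using cinner_add_left[of x "-y" z] by (simp add: cinner_minus_left)

lemma cinner_diff_right: "cinner x (y - z) = cinner x y - cinner x z"
  using cinner_add_right[of x y "-z"] by (simp add: cinner_minus_right)

lemma cinner_self: "cinner x x = complex_of_real ((norm x)\<^sup>2)"
proof (rule complex_eqI)
  show "Re (cinner x x) = Re (complex_of_real ((norm x)\<^sup>2))"
    by (simp flip: inner_eq_Re_cinner add: power2_norm_eq_inner)
  show "Im (cinner x x) = Im (complex_of_real ((norm x)\<^sup>2))"
    by (metis Im_complex_of_real Reals_cnj_iff cinner_commute complex_is_Real_iff)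
qed

lemma cinner_ext_right:
  assumes "\<And>x. cinner x y = cinner x z"
  shows "y = z"
proof -
  have "cinner (y - z) (y - z) = 0"
    using assms by (simp add: cinner_diff_right)
  then show ?thesis by (simp add: cinner_self)
qed

lemma norm_scaleC: "norm (c *\<^sub>C x) = cmod c * norm (x::'a::complex_inner)"
proof -
  have "cinner (c *\<^sub>C x) (c *\<^sub>C x) = (c * cnj c) * cinner x x"
    by (simp add: cinner_scaleC_left cinner_scaleC_right)
  then have "complex_of_real ((norm (c *\<^sub>C x))\<^sup>2) = of_real ((cmod c * norm x)\<^sup>2)"
    by (simp add: cinner_self power_mult_distrib flip: complex_norm_square)
  then show ?thesis
    by (metis norm_ge_zero of_real_eq_iff power2_eq_iff_nonneg zero_le_mult_iff)
qed

lemma cmod_cinner_le: "cmod (cinner x y) \<le> norm x * norm y"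
proof (cases "cinner x y = 0")
  case False
  let ?c = "cinner x y"
  have "(cmod ?c)\<^sup>2 = Re (cnj ?c * ?c)"
    by (simp add: cmod_power2) (simp add: power2_eq_square)
  also have "\<dots> = inner (cnj ?c *\<^sub>C x) y"
    by (simp add: inner_eq_Re_cinner cinner_scaleC_left)
  also have "\<dots> \<le> norm (cnj ?c *\<^sub>C x) * norm y"
    by (rule norm_cauchy_schwarz)
  finally have "cmod ?c * cmod ?c \<le> cmod ?c * (norm x * norm y)"
    by (simp add: norm_scaleC power2_eq_square mult.assoc)
  then show ?thesis using False by simp
qed simp

lemma Re_cinner_le: "Re (cinner x y) \<le> norm x * norm y"
  using cmod_cinner_le[of x y] complex_Re_le_cmod[of "cinner x y"] by linarith

section \<open>Bounded operators\<close>

lemma bounded_clinearI: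
  assumes "\<And>x y. T (x + y) = T x + T y" "\<And>c x. T (c *\<^sub>C x) = c *\<^sub>C T x"
    and "\<And>x. norm (T x) \<le> K * norm x"
  shows "bounded_clinear T"
  unfolding bounded_clinear_def
proof (intro conjI allI)
  show "bounded_linear T"
    by (rule bounded_linear_intro[where K = K])
      (use assms in \<open>simp_all add: scaleR_eq_scaleC mult.commute\<close>)
qed (use assms in auto)

lemma bounded_clinear_imp_bounded_linear: "bounded_clinear T \<Longrightarrow> bounded_linear T"
  by (simp add: bounded_clinear_def)

lemma bounded_clinear_scaleC: "bounded_clinear T \<Longrightarrow> T (c *\<^sub>C x) = c *\<^sub>C T x"
  by (simp add: bounded_clinear_def)

lemma
  assumes "bounded_clinear T"
  shows bounded_clinear_add: "T (x + y) = T x + T y"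
    and bounded_clinear_diff: "T (x - y) = T x - T y"
    and bounded_clinear_zero: "T 0 = 0"
proof -
  interpret bounded_linear T by (rule bounded_clinear_imp_bounded_linear[OF assms])
  show "T (x + y) = T x + T y" "T (x - y) = T x - T y" "T 0 = 0"
    by (simp_all add: add diff zero)
qed

lemma bounded_clinear_bound:
  assumes "bounded_clinear T"
  shows "norm (T x) \<le> onorm T * norm x"
  using assms by (intro onorm bounded_clinear_imp_bounded_linear)

lemma onorm_nonneg: "bounded_clinear T \<Longrightarrow> 0 \<le> onorm T"
  by (intro onorm_pos_le bounded_clinear_imp_bounded_linear)

lemma bounded_clinear_id: "bounded_clinear (\<lambda>x. x)"
  by (rule bounded_clinearI[where K = 1]) auto

lemma bounded_clinear_zero_op: "bounded_clinear (\<lambda>x. 0)"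
  by (rule bounded_clinearI[where K = 0]) auto

lemma bounded_clinear_compose:
  assumes "bounded_clinear S" "bounded_clinear T"
  shows "bounded_clinear (\<lambda>x. S (T x))"
  using assms unfolding bounded_clinear_def
  by (auto intro: bounded_linear_compose)

lemma bounded_clinear_plus:
  assumes "bounded_clinear S" "bounded_clinear T"
  shows "bounded_clinear (\<lambda>x. S x + T x)"
  using assms unfolding bounded_clinear_def
  by (auto intro: bounded_linear_add simp: scaleC_add_right)

lemma bounded_clinear_minus:
  assumes "bounded_clinear S" "bounded_clinear T"
  shows "bounded_clinear (\<lambda>x. S x - T x)"
  using assms unfolding bounded_clinear_def
  by (auto intro: bounded_linear_sub simp: scaleC_diff_right)

lemma bounded_clinear_scale:
  assumes "bounded_clinear T"
  shows "bounded_clinear (\<lambda>x. c *\<^sub>C T x)"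
proof (rule bounded_clinearI[where K = "cmod c * onorm T"])
  fix x
  show "norm (c *\<^sub>C T x) \<le> cmod c * onorm T * norm x"
    using bounded_clinear_bound[OF assms, of x] by (simp add: norm_scaleC mult_left_mono mult.assoc)
qed (simp_all add: bounded_clinear_add[OF assms] bounded_clinear_scaleC[OF assms] scaleC_add_right
    scaleC_scaleC mult.commute)

section \<open>Orthogonality, adjoints and inverses in Hilbert space\<close>

text \<open>
  A sequence in the subspace whose distances to a point \<open>x\<close> outside it tend to the infimum is Cauchy
  by the parallelogram law; its limit \<open>m\<close> is the nearest point, and \<open>x - m\<close> is orthogonal to the
  subspace.
\<close>

lemma exists_orthogonal_to_closed_subspace:
  fixes M :: "'a::{real_inner, complete_space} set"
  assumes sub: "subspace M" and cl: "closed M" and x: "x \<notin> M"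
  obtains y where "y \<noteq> 0" "\<And>m. m \<in> M \<Longrightarrow> inner m y = 0"
proof -
  define d where "d = (INF m\<in>M. (norm (x - m))\<^sup>2)"
  have ne: "M \<noteq> {}" using subspace_0[OF sub] by auto
  have d_le: "d \<le> (norm (x - m))\<^sup>2" if "m \<in> M" for m
    unfolding d_def by (rule cINF_lower[OF _ that]) (auto intro: bdd_belowI2[where m = 0])
  have "\<exists>m\<in>M. (norm (x - m))\<^sup>2 < d + 1 / (real n + 1)" for n
  proof (rule ccontr)
    assume "\<not> ?thesis"
    then have "d + 1 / (real n + 1) \<le> d"
      unfolding d_def by (intro cINF_greatest[OF ne]) (auto simp: not_less)
    then show False by (simp add: field_simps)
  qed
  then obtain s where s: "\<And>n. s n \<in> M" "\<And>n. (norm (x - s n))\<^sup>2 < d + 1 / (real n + 1)"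
    by metis
  have par: "(norm (s i - s j))\<^sup>2 \<le> 2 / (real i + 1) + 2 / (real j + 1)" for i j
  proof -
    let ?m = "(1/2) *\<^sub>R (s i + s j)"
    have "?m \<in> M" using s(1) sub by (simp add: subspace_add subspace_scale)
    then have 1: "d \<le> (norm (x - ?m))\<^sup>2" by (rule d_le)
    have 2: "(norm (s i - s j))\<^sup>2 =
        2 * (norm (x - s i))\<^sup>2 + 2 * (norm (x - s j))\<^sup>2 - 4 * (norm (x - ?m))\<^sup>2"
      by (simp add: power2_norm_eq_inner inner_diff_left inner_diff_right inner_add_left
          inner_add_right inner_commute algebra_simps)
    show ?thesis using 1 2 s(2)[of i] s(2)[of j] by (simp add: algebra_simps)
  qed
  have "Cauchy s"
  proof (rule metric_CauchyI)
    fix e :: real assume e: "e > 0"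
    obtain N where N: "4 / (e\<^sup>2) < real N" using reals_Archimedean2 by blast
    show "\<exists>K. \<forall>i\<ge>K. \<forall>j\<ge>K. dist (s i) (s j) < e"
    proof (intro exI allI impI)
      fix i j assume ij: "i \<ge> N" "j \<ge> N"
      have "2 / (real i + 1) \<le> 2 / (real N + 1)" "2 / (real j + 1) \<le> 2 / (real N + 1)"
        using ij by (auto intro!: divide_left_mono)
      then have "(norm (s i - s j))\<^sup>2 \<le> 4 / (real N + 1)" using par[of i j] by simp
      also have "\<dots> < e\<^sup>2" using N e by (simp add: field_simps) 
          (smt (verit) zero_less_power)
      finally show "dist (s i) (s j) < e"
        using e by (simp add: dist_norm power2_less_imp_less)
    qed
  qed
  then obtain m where m: "s \<longlonglongrightarrow> m" using Cauchy_convergent convergent_def by blast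
  have mM: "m \<in> M" using closed_sequentially[OF cl] s(1) m by blast
  have "(\<lambda>n. (norm (x - s n))\<^sup>2) \<longlonglongrightarrow> (norm (x - m))\<^sup>2" by (intro tendsto_intros m)
  moreover have "(\<lambda>n. d + 1 / (real n + 1)) \<longlonglongrightarrow> d"
    using tendsto_add[OF tendsto_const[of d] LIMSEQ_inverse_real_of_nat]
    by (simp add: divide_inverse add.commute)
  ultimately have md: "(norm (x - m))\<^sup>2 \<le> d"
    by (rule LIMSEQ_le) (use s(2) less_imp_le in blast)
  show ?thesis
  proof
    show "x - m \<noteq> 0" using x mM by auto
    fix k assume k: "k \<in> M"
    show "inner k (x - m) = 0"
    proof (cases "k = 0")
      case False
      define t where "t = inner k (x - m) / (norm k)\<^sup>2"
      have "m + t *\<^sub>R k \<in> M" using mM k sub by (simp add: subspace_add subspace_scale)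
      then have "(norm (x - m))\<^sup>2 \<le> (norm (x - (m + t *\<^sub>R k)))\<^sup>2"
        using d_le md by (meson order_trans)
      also have "x - (m + t *\<^sub>R k) = (x - m) - t *\<^sub>R k" by simp
      also have "(norm ((x - m) - t *\<^sub>R k))\<^sup>2 =
          (norm (x - m))\<^sup>2 - 2 * t * inner k (x - m) + t\<^sup>2 * (norm k)\<^sup>2"
        unfolding power2_norm_eq_inner
        by (simp only: inner_diff_left inner_diff_right inner_commute inner_scaleR_left
            inner_scaleR_right) (simp add: algebra_simps power2_eq_square inner_commute)
      also have "\<dots> = (norm (x - m))\<^sup>2 - (inner k (x - m))\<^sup>2 / (norm k)\<^sup>2"
        using False unfolding t_def by (simp add: field_simps power2_eq_square)
      finally show ?thesis using False by (simp add: field_simps)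
    qed simp
  qed
qed

text \<open>The representing vector is a multiple of a vector orthogonal to the kernel.\<close>

lemma riesz_representation_real:
  fixes \<phi> :: "'a::{real_inner, complete_space} \<Rightarrow> real"
  assumes "bounded_linear \<phi>"
  shows "\<exists>w. \<forall>x. \<phi> x = inner x w"
proof (cases "\<forall>x. \<phi> x = 0")
  case True
  then show ?thesis by (intro exI[of _ 0]) simp
next
  case False
  interpret bounded_linear \<phi> by fact
  let ?M = "{x. \<phi> x = 0}"
  have "subspace ?M" by (auto simp: subspace_def add scaleR zero)
  moreover have "closed ?M"
    by (rule closed_Collect_eq) (auto intro: continuous_on continuous_intros)
  ultimately obtain y where y: "y \<noteq> 0" "\<And>m. m \<in> ?M \<Longrightarrow> inner m y = 0"
    using exists_orthogonal_to_closed_subspace False by blast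
  have "\<phi> x = inner x ((\<phi> y / (norm y)\<^sup>2) *\<^sub>R y)" for x
  proof -
    have "\<phi> y *\<^sub>R x - \<phi> x *\<^sub>R y \<in> ?M" by (simp add: diff scaleR)
    then have "inner (\<phi> y *\<^sub>R x - \<phi> x *\<^sub>R y) y = 0" by (rule y)
    then have "\<phi> y * inner x y = \<phi> x * (norm y)\<^sup>2"
      by (simp add: inner_diff_left power2_norm_eq_inner)
    then show ?thesis using y(1) by (simp add: field_simps)
  qed
  then show ?thesis by blast
qed

text \<open>A complex linear functional is determined by its real part, so the real representation theorem
  yields the complex one.\<close>

lemma cinner_eq_of_Re_cinner_eq:
  assumes "\<And>x. Re (cinner (S x) y) = Re (cinner x w)" "\<And>x. S (\<i> *\<^sub>C x) = \<i> *\<^sub>C S x"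
  shows "cinner (S x) y = cinner x w"
proof (rule complex_eqI)
  show "Im (cinner (S x) y) = Im (cinner x w)"
    using assms(1)[of "\<i> *\<^sub>C x"] by (simp add: assms(2) cinner_scaleC_left)
qed (rule assms)

lemma cadjoint_eqI:
  assumes "\<And>x y. cinner (T x) y = cinner x (R y)"
  shows "T\<^sup>\<dagger> = R"
  unfolding cadjoint_def
proof (rule the_equality)
  fix R' assume "\<forall>x y. cinner (T x) y = cinner x (R' y)"
  then show "R' = R" using assms by (intro ext cinner_ext_right) metis
qed (use assms in blast)

lemma cinner_cadjoint_right:
  fixes T :: "'a::chilbert_space \<Rightarrow> 'b::complex_inner"
  assumes T: "bounded_clinear T"
  shows "cinner x ((T\<^sup>\<dagger>) y) = cinner (T x) y"
proof -
  have "\<exists>w. \<forall>x. cinner (T x) y = cinner x w" for y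
  proof -
    have "bounded_linear (\<lambda>x. Re (cinner (T x) y))"
      using bounded_linear_compose[OF bounded_linear_inner_left[of y]
          bounded_clinear_imp_bounded_linear[OF T]]
      by (simp add: inner_eq_Re_cinner)
    then obtain w where "\<forall>x. Re (cinner (T x) y) = inner x w"
      using riesz_representation_real by blast
    then have "cinner (T x) y = cinner x w" for x
      by (intro cinner_eq_of_Re_cinner_eq)
        (auto simp: inner_eq_Re_cinner bounded_clinear_scaleC[OF T])
    then show ?thesis by blast
  qed
  then obtain R where R: "\<And>x y. cinner (T x) y = cinner x (R y)" by metis
  then show ?thesis using cadjoint_eqI[OF R] by simp
qed

lemma cinner_cadjoint_left:
  fixes T :: "'a::chilbert_space \<Rightarrow> 'b::complex_inner"
  assumes "bounded_clinear T"
  shows "cinner ((T\<^sup>\<dagger>) y) x = cinner y (T x)"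
  by (metis assms cinner_cadjoint_right cinner_commute)

lemma bounded_clinear_cadjoint:
  fixes T :: "'a::chilbert_space \<Rightarrow> 'b::complex_inner"
  assumes T: "bounded_clinear T"
  shows "bounded_clinear (T\<^sup>\<dagger>)"
proof (rule bounded_clinearI[where K = "onorm T"])
  fix x y :: 'b and c
  show "(T\<^sup>\<dagger>) (x + y) = (T\<^sup>\<dagger>) x + (T\<^sup>\<dagger>) y"
    by (rule cinner_ext_right) (simp add: cinner_cadjoint_right[OF T] cinner_add_right)
  show "(T\<^sup>\<dagger>) (c *\<^sub>C x) = c *\<^sub>C (T\<^sup>\<dagger>) x"
    by (rule cinner_ext_right) (simp add: cinner_cadjoint_right[OF T] cinner_scaleC_right)
  let ?n = "norm ((T\<^sup>\<dagger>) x)"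
  have "?n * ?n = Re (cinner ((T\<^sup>\<dagger>) x) ((T\<^sup>\<dagger>) x))"
    by (simp add: cinner_self power2_eq_square)
  also have "\<dots> = Re (cinner x (T ((T\<^sup>\<dagger>) x)))" by (simp add: cinner_cadjoint_left[OF T])
  also have "\<dots> \<le> norm x * norm (T ((T\<^sup>\<dagger>) x))" by (rule Re_cinner_le)
  also have "\<dots> \<le> norm x * (onorm T * ?n)"
    by (intro mult_left_mono bounded_clinear_bound T) simp
  finally have "?n * ?n \<le> (onorm T * norm x) * ?n" by (simp add: algebra_simps)
  then show "?n \<le> onorm T * norm x"
    using onorm_nonneg[OF T] by (cases "?n = 0") (simp, simp)
qed

lemma cadjoint_cadjoint:
  fixes T :: "'a::chilbert_space \<Rightarrow> 'b::chilbert_space"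
  assumes "bounded_clinear T"
  shows "(T\<^sup>\<dagger>)\<^sup>\<dagger> = T"
  by (rule cadjoint_eqI) (rule cinner_cadjoint_left[OF assms])

definition op_invertible :: "('a::complex_inner \<Rightarrow> 'a) \<Rightarrow> bool" where
  "op_invertible S \<longleftrightarrow> (\<exists>R. bounded_clinear R \<and> R \<circ> S = id \<and> S \<circ> R = id)"

lemma op_spectrum_iff: "z \<in> op_spectrum T \<longleftrightarrow> \<not> op_invertible (\<lambda>x. T x - z *\<^sub>C x)"
  by (simp add: op_spectrum_def op_invertible_def)

lemma op_invertible_compose:
  assumes "op_invertible S" "op_invertible T"
  shows "op_invertible (\<lambda>x. S (T x))"
proof -
  obtain P Q where "bounded_clinear P" "P \<circ> S = id" "S \<circ> P = id"
    "bounded_clinear Q" "Q \<circ> T = id" "T \<circ> Q = id"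
    using assms unfolding op_invertible_def by blast
  then show ?thesis unfolding op_invertible_def
    by (intro exI[of _ "\<lambda>x. Q (P x)"]) (auto simp: fun_eq_iff intro: bounded_clinear_compose)
qed

text \<open>If \<open>R\<close> inverts the product then \<open>T R\<close> is a right inverse of \<open>S\<close>, and it is two-sided because the
  factors commute.\<close>

lemma op_invertible_left_factor:
  assumes "op_invertible (\<lambda>x. S (T x))" and comm: "\<And>x. S (T x) = T (S x)"
    and T: "bounded_clinear T"
  shows "op_invertible S"
proof -
  obtain R where R: "bounded_clinear R" "\<And>x. R (S (T x)) = x" "\<And>x. S (T (R x)) = x"
    using assms(1) unfolding op_invertible_def by (auto simp: fun_eq_iff)
  have "R (T (S x)) = x" for x using R(2) comm by metis
  moreover have "T (R x) = R (T x)" for x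
    by (metis R(2,3) comm)
  ultimately show ?thesis unfolding op_invertible_def
    using R by (intro exI[of _ "\<lambda>x. T (R x)"]) (auto simp: fun_eq_iff intro: bounded_clinear_compose T)
qed

text \<open>
  Coercivity bounds \<open>S\<close> below, which makes it injective with closed range; and a vector orthogonal to
  the range is orthogonal to its own image, hence zero.
\<close>

lemma lax_milgram:
  fixes S :: "'a::chilbert_space \<Rightarrow> 'a"
  assumes S: "bounded_clinear S" and c: "c > 0"
    and coercive: "\<And>x. c * (norm x)\<^sup>2 \<le> cmod (cinner (S x) x)"
  shows "op_invertible S"
proof -
  have below: "c * norm x \<le> norm (S x)" for x
  proof (cases "x = 0")
    case False
    have "(c * norm x) * norm x \<le> norm (S x) * norm x"
      using coercive[of x] cmod_cinner_le[of "S x" x] by (simp add: power2_eq_square mult.assoc)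
    then show ?thesis using False by simp
  qed (simp add: bounded_clinear_zero[OF S])
  have inj: "x = y" if "S x = S y" for x y
    using below[of "x - y"] c that
    by (simp add: bounded_clinear_diff[OF S]) (metis eq_iff_diff_eq_0 mult_pos_pos not_le zero_less_norm_iff)
  interpret bounded_linear S by (rule bounded_clinear_imp_bounded_linear[OF S])
  have cl: "closed (range S)"
  proof (unfold closed_sequential_limits, intro allI impI)
    fix s l assume "(\<forall>n. s n \<in> range S) \<and> s \<longlonglongrightarrow> l"
    then obtain r where r: "\<And>n. s n = S (r n)" and l: "s \<longlonglongrightarrow> l"
      by (auto simp: image_iff) metis
    have "Cauchy r"
    proof (rule metric_CauchyI)
      fix e :: real assume "e > 0"
      then obtain N where N: "\<And>i j. i \<ge> N \<Longrightarrow> j \<ge> N \<Longrightarrow> dist (s i) (s j) < c * e"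
        using metric_CauchyD[OF LIMSEQ_imp_Cauchy[OF l], of "c * e"] c by auto
      have "dist (r i) (r j) < e" if "i \<ge> N" "j \<ge> N" for i j
        using below[of "r i - r j"] N[OF that] c
        by (simp add: dist_norm r diff) (metis le_less_trans mult_less_cancel_left_pos)
      then show "\<exists>N. \<forall>i\<ge>N. \<forall>j\<ge>N. dist (r i) (r j) < e" by blast
    qed
    then obtain x where "r \<longlonglongrightarrow> x" using Cauchy_convergent convergent_def by blast
    then have "s \<longlonglongrightarrow> S x" unfolding r by (rule tendsto)
    then show "l \<in> range S" using l LIMSEQ_unique by blast
  qed
  have surj: "y \<in> range S" for y
  proof (rule ccontr)
    assume "y \<notin> range S"
    then obtain w where w: "w \<noteq> 0" "\<And>m. m \<in> range S \<Longrightarrow> inner m w = 0"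
      using exists_orthogonal_to_closed_subspace[OF _ cl] linear_subspace_image[OF linear subspace_UNIV]
      by metis
    have "Re (cinner (S w) w) = 0" using w(2)[of "S w"] by (simp add: inner_eq_Re_cinner)
    moreover have "Im (cinner (S w) w) = 0"
      using w(2)[OF rangeI, of "\<i> *\<^sub>C w"]
      by (simp add: inner_eq_Re_cinner bounded_clinear_scaleC[OF S] cinner_scaleC_left)
    ultimately have "cinner (S w) w = 0" by (simp add: complex_eqI)
    then show False using coercive[of w] c w(1) by (simp add: mult_le_0_iff)
  qed
  define R where "R = inv S"
  have SR: "S (R y) = y" for y unfolding R_def using surj by (simp add: f_inv_into_f)
  have RS: "R (S x) = x" for x using inj SR by blast
  have "bounded_clinear R"
  proof (rule bounded_clinearI[where K = "1 / c"])
    show "R (x + y) = R x + R y" for x y by (rule inj) (simp add: SR add)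
    show "R (a *\<^sub>C x) = a *\<^sub>C R x" for a x by (rule inj) (simp add: SR bounded_clinear_scaleC[OF S])
    show "norm (R x) \<le> 1 / c * norm x" for x
      using below[of "R x"] c by (simp add: SR field_simps)
  qed
  then show ?thesis unfolding op_invertible_def using SR RS by (auto simp: fun_eq_iff)
qed

section \<open>The spectrum\<close>

definition selfadjoint :: "('a::complex_inner \<Rightarrow> 'a) \<Rightarrow> bool" where
  "selfadjoint T \<longleftrightarrow> bounded_clinear T \<and> (\<forall>x y. cinner (T x) y = cinner x (T y))"

lemma selfadjoint_bounded_clinear: "selfadjoint T \<Longrightarrow> bounded_clinear T"
  by (simp add: selfadjoint_def)

lemma selfadjoint_cinner: "selfadjoint T \<Longrightarrow> cinner (T x) y = cinner x (T y)"
  by (simp add: selfadjoint_def)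

lemma selfadjoint_Im_cinner: "selfadjoint T \<Longrightarrow> Im (cinner (T x) x) = 0"
  by (metis selfadjoint_cinner cinner_commute Reals_cnj_iff complex_is_Real_iff)

text \<open>Polarization: a quadratic form with real values comes from a Hermitian sesquilinear form.\<close>

lemma positive_op_selfadjoint:
  assumes "positive_op T"
  shows "selfadjoint T"
proof -
  have T: "bounded_clinear T" and real: "\<And>x. Im (cinner (T x) x) = 0"
    using assms by (auto simp: positive_op_def)
  have sym: "Im (cinner (T x) y) = Im (cinner x (T y))" for x y
  proof -
    have "Im (cinner (T x) y) + Im (cinner (T y) x) = 0"
      using real[of "x + y"] real[of x] real[of y]
      by (simp add: bounded_clinear_add[OF T] cinner_add_left cinner_add_right)
    moreover have "Im (cinner (T y) x) = - Im (cinner x (T y))"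
      by (subst cinner_commute) simp
    ultimately show ?thesis by simp
  qed
  have "Re (cinner (T x) y) = Re (cinner x (T y))" for x y
    using sym[of "\<i> *\<^sub>C x" y] by (simp add: bounded_clinear_scaleC[OF T] cinner_scaleC_left)
  then show ?thesis unfolding selfadjoint_def using T sym by (simp add: complex_eq_iff)
qed

lemma bounded_clinear_shift: "bounded_clinear T \<Longrightarrow> bounded_clinear (\<lambda>x. T x - z *\<^sub>C x)"
  by (intro bounded_clinear_minus bounded_clinear_scale bounded_clinear_id)

lemma cinner_shift: "cinner (T x - z *\<^sub>C x) x = cinner (T x) x - z * of_real ((norm x)\<^sup>2)"
  by (simp add: cinner_diff_left cinner_scaleC_left cinner_self)

text \<open>For a number \<open>z\<close> off the real axis the shift \<open>T - z\<close> is coercive with constant \<open>\<bar>Im z\<bar>\<close>, hence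
  invertible.  The two bounds on the spectrum below come from coercivity of the shift as well, with
  constants \<open>\<bar>z\<bar> - \<parallel>T\<parallel>\<close> and \<open>- Re z\<close>.\<close>

lemma op_spectrum_selfadjoint_real:
  fixes T :: "'a::chilbert_space \<Rightarrow> 'a"
  assumes T: "selfadjoint T" and z: "z \<in> op_spectrum T"
  shows "Im z = 0"
proof (rule ccontr)
  assume "Im z \<noteq> 0"
  have "\<bar>Im z\<bar> * (norm x)\<^sup>2 \<le> cmod (cinner (T x - z *\<^sub>C x) x)" for x
    using abs_Im_le_cmod[of "cinner (T x - z *\<^sub>C x) x"]
    by (simp add: cinner_shift selfadjoint_Im_cinner[OF T] abs_mult)
  then have "op_invertible (\<lambda>x. T x - z *\<^sub>C x)"
    using \<open>Im z \<noteq> 0\<close> selfadjoint_bounded_clinear[OF T]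
    by (intro lax_milgram[where c = "\<bar>Im z\<bar>"] bounded_clinear_shift) auto
  then show False using z by (simp add: op_spectrum_iff)
qed

lemma op_spectrum_selfadjoint_of_real:
  fixes T :: "'a::chilbert_space \<Rightarrow> 'a"
  assumes "selfadjoint T" "z \<in> op_spectrum T"
  shows "complex_of_real (Re z) = z"
  using op_spectrum_selfadjoint_real[OF assms] by (simp add: complex_eq_iff)

lemma op_spectrum_norm_le:
  fixes T :: "'a::chilbert_space \<Rightarrow> 'a"
  assumes T: "bounded_clinear T" and z: "z \<in> op_spectrum T"
  shows "cmod z \<le> onorm T"
proof (rule ccontr)
  assume less: "\<not> cmod z \<le> onorm T"
  have "(cmod z - onorm T) * (norm x)\<^sup>2 \<le> cmod (cinner (T x - z *\<^sub>C x) x)" for x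
  proof -
    have "cmod (cinner (T x) x) \<le> onorm T * norm x * norm x"
      using cmod_cinner_le[of "T x" x] mult_right_mono[OF bounded_clinear_bound[OF T, of x], of "norm x"]
      by simp
    moreover have "cmod z * (norm x)\<^sup>2 - cmod (cinner (T x) x) \<le> cmod (cinner (T x - z *\<^sub>C x) x)"
      using norm_triangle_ineq2[of "z * of_real ((norm x)\<^sup>2)" "cinner (T x) x"]
      by (simp add: cinner_shift norm_mult norm_minus_commute norm_power)
    ultimately show ?thesis by (simp add: algebra_simps power2_eq_square)
  qed
  then have "op_invertible (\<lambda>x. T x - z *\<^sub>C x)"
    using less by (intro lax_milgram[where c = "cmod z - onorm T"] bounded_clinear_shift T) auto
  then show False using z by (simp add: op_spectrum_iff)
qed

lemma op_spectrum_positive: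
  fixes T :: "'a::chilbert_space \<Rightarrow> 'a"
  assumes T: "positive_op T" and z: "z \<in> op_spectrum T"
  shows "0 \<le> Re z"
proof (rule ccontr)
  assume neg: "\<not> 0 \<le> Re z"
  have "(- Re z) * (norm x)\<^sup>2 \<le> cmod (cinner (T x - z *\<^sub>C x) x)" for x
  proof -
    have "0 \<le> Re (cinner (T x) x)" using T by (simp add: positive_op_def)
    then show ?thesis
      using complex_Re_le_cmod[of "cinner (T x - z *\<^sub>C x) x"] by (simp add: cinner_shift)
  qed
  then have "op_invertible (\<lambda>x. T x - z *\<^sub>C x)"
    using neg T unfolding positive_op_def
    by (intro lax_milgram[where c = "- Re z"] bounded_clinear_shift) auto
  then show False using z by (simp add: op_spectrum_iff)
qed

text \<open>
  If \<open>T - z\<close> has the inverse \<open>R\<close> then \<open>T - w = (T - z) (1 - (w - z) R)\<close>, and the second factor is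
  coercive as soon as \<open>\<bar>w - z\<bar> \<parallel>R\<parallel> < 1\<close>.
\<close>

lemma closed_op_spectrum:
  fixes T :: "'a::chilbert_space \<Rightarrow> 'a"
  assumes T: "bounded_clinear T"
  shows "closed (op_spectrum T)"
proof -
  have "\<exists>e>0. \<forall>w. dist w z < e \<longrightarrow> w \<notin> op_spectrum T" if z: "z \<notin> op_spectrum T" for z
  proof -
    let ?S = "\<lambda>x. T x - z *\<^sub>C x"
    obtain R where R: "bounded_clinear R" and SR: "\<And>x. ?S (R x) = x" and inv: "op_invertible ?S"
      using z unfolding op_spectrum_iff op_invertible_def by (auto simp: fun_eq_iff)
    define e where "e = 1 / (onorm R + 1)"
    have e: "e > 0" using onorm_nonneg[OF R] by (simp add: e_def)
    have S: "bounded_clinear ?S" by (rule bounded_clinear_shift[OF T])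
    have "w \<notin> op_spectrum T" if w: "dist w z < e" for w
    proof -
      let ?d = "w - z"
      have "cmod ?d * onorm R \<le> cmod ?d * (onorm R + 1)" by (simp add: mult_left_mono)
      also have "\<dots> < 1" using w onorm_nonneg[OF R] by (simp add: e_def dist_norm field_simps)
      finally have c: "0 < 1 - cmod ?d * onorm R" by simp
      have "(1 - cmod ?d * onorm R) * (norm x)\<^sup>2 \<le> cmod (cinner (x - ?d *\<^sub>C R x) x)" for x
      proof -
        have "cmod (cinner (?d *\<^sub>C R x) x) \<le> cmod ?d * norm (R x) * norm x"
          using cmod_cinner_le[of "?d *\<^sub>C R x" x] by (simp add: norm_scaleC)
        also have "\<dots> \<le> cmod ?d * (onorm R * norm x) * norm x"
          by (intro mult_right_mono mult_left_mono bounded_clinear_bound[OF R]) auto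
        finally have "cmod (cinner (?d *\<^sub>C R x) x) \<le> cmod ?d * onorm R * (norm x)\<^sup>2"
          by (simp add: power2_eq_square mult.assoc)
        moreover have "(norm x)\<^sup>2 - cmod (cinner (?d *\<^sub>C R x) x) \<le> cmod (cinner (x - ?d *\<^sub>C R x) x)"
          using norm_triangle_ineq2[of "cinner x x" "cinner (?d *\<^sub>C R x) x"]
          by (simp add: cinner_diff_left) (simp add: cinner_self norm_power)
        ultimately show ?thesis by (simp add: algebra_simps)
      qed
      then have "op_invertible (\<lambda>x. x - ?d *\<^sub>C R x)"
        by (intro lax_milgram[OF _ c] bounded_clinear_minus bounded_clinear_id bounded_clinear_scale R)
      then have "op_invertible (\<lambda>x. ?S (x - ?d *\<^sub>C R x))" by (rule op_invertible_compose[OF inv])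
      moreover have "(\<lambda>x. ?S (x - ?d *\<^sub>C R x)) = (\<lambda>x. T x - w *\<^sub>C x)"
      proof
        fix x
        have "?S (x - ?d *\<^sub>C R x) = ?S x - ?d *\<^sub>C x"
          by (simp only: bounded_clinear_diff[OF S] bounded_clinear_scaleC[OF S] SR)
        then show "?S (x - ?d *\<^sub>C R x) = T x - w *\<^sub>C x" by (simp add: scaleC_diff_left)
      qed
      ultimately show ?thesis by (simp add: op_spectrum_iff)
    qed
    then show ?thesis using e by blast
  qed
  then show ?thesis unfolding closed_def open_dist by auto
qed

lemma compact_op_spectrum:
  fixes T :: "'a::chilbert_space \<Rightarrow> 'a"
  assumes T: "bounded_clinear T"
  shows "compact (op_spectrum T)"
  unfolding compact_eq_bounded_closed
  using closed_op_spectrum[OF T] op_spectrum_norm_le[OF T] by (auto simp: bounded_iff)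

section \<open>Polynomials of an operator\<close>

text \<open>Horner's scheme, so that identities follow by induction on the coefficients.\<close>

definition op_poly :: "('a::complex_inner \<Rightarrow> 'a) \<Rightarrow> complex poly \<Rightarrow> 'a \<Rightarrow> 'a" where
  "op_poly T q = fold_coeffs (\<lambda>a F x. a *\<^sub>C x + T (F x)) q (\<lambda>_. 0)"

lemma op_poly_0 [simp]: "op_poly T 0 x = 0"
  by (simp add: op_poly_def)

lemma op_poly_pCons:
  assumes "bounded_clinear T"
  shows "op_poly T (pCons a q) x = a *\<^sub>C x + T (op_poly T q x)"
  using bounded_clinear_zero[OF assms]
  by (cases "a = 0 \<and> q = 0") (auto simp: op_poly_def)

lemma bounded_clinear_op_poly:
  assumes T: "bounded_clinear T"
  shows "bounded_clinear (op_poly T q)"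
proof (induction q)
  case 0
  then show ?case using bounded_clinear_zero_op by (simp add: op_poly_def)
next
  case (pCons a q)
  have "bounded_clinear (\<lambda>x. a *\<^sub>C x + T (op_poly T q x))"
    by (intro bounded_clinear_plus bounded_clinear_scale bounded_clinear_id
        bounded_clinear_compose[OF T] pCons)
  then show ?case by (simp add: op_poly_pCons[OF T, abs_def])
qed

lemma op_poly_add:
  assumes T: "bounded_clinear T"
  shows "op_poly T (p + q) x = op_poly T p x + op_poly T q x"
  by (induction p q rule: poly_induct2)
    (auto simp: op_poly_pCons[OF T] bounded_clinear_add[OF T] scaleC_add_left)

lemma op_poly_diff:
  assumes T: "bounded_clinear T"
  shows "op_poly T (p - q) x = op_poly T p x - op_poly T q x"
  by (induction p q rule: poly_induct2)
    (auto simp: op_poly_pCons[OF T] bounded_clinear_diff[OF T] scaleC_diff_left)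

lemma op_poly_smult:
  assumes T: "bounded_clinear T"
  shows "op_poly T (smult c p) x = c *\<^sub>C op_poly T p x"
  by (induction p)
    (auto simp: op_poly_pCons[OF T] bounded_clinear_scaleC[OF T] scaleC_add_right scaleC_scaleC)

lemma op_poly_mult:
  assumes T: "bounded_clinear T"
  shows "op_poly T (p * q) x = op_poly T p (op_poly T q x)"
  by (induction p)
    (auto simp: op_poly_pCons[OF T] op_poly_add[OF T] op_poly_smult[OF T])

lemma op_poly_const [simp]:
  "bounded_clinear T \<Longrightarrow> op_poly T [:c:] x = c *\<^sub>C x"
  by (simp add: op_poly_pCons bounded_clinear_zero)

lemma op_poly_1 [simp]: "bounded_clinear T \<Longrightarrow> op_poly T 1 x = x"
  using op_poly_const[of T 1 x] by (simp add: scaleC_one flip: one_pCons)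

lemma op_poly_linear:
  "bounded_clinear T \<Longrightarrow> op_poly T [:c, 1:] x = c *\<^sub>C x + T x"
  by (simp add: op_poly_pCons bounded_clinear_zero scaleC_one)

lemma op_poly_commute:
  assumes T: "bounded_clinear T"
  shows "op_poly T q (T x) = T (op_poly T q x)"
  by (induction q)
    (auto simp: op_poly_pCons[OF T] bounded_clinear_add[OF T] bounded_clinear_scaleC[OF T]
      bounded_clinear_zero[OF T])

lemma cinner_op_poly:
  assumes T: "selfadjoint T"
  shows "cinner (op_poly T q x) y = cinner x (op_poly T (map_poly cnj q) y)"
proof (induction q arbitrary: y)
  case (pCons a q)
  note T' = selfadjoint_bounded_clinear[OF T]
  show ?case
    by (simp add: op_poly_pCons[OF T'] map_poly_pCons cinner_add_left cinner_add_right
        cinner_scaleC_left cinner_scaleC_right selfadjoint_cinner[OF T] pCons.IH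
        op_poly_commute[OF T'])
qed simp

lemma cinner_op_poly_cnj:
  assumes T: "selfadjoint T"
  shows "cinner (op_poly T (map_poly cnj q) x) y = cinner x (op_poly T q y)"
  by (metis cinner_op_poly[OF T] cinner_commute)

text \<open>The spectral mapping theorem: factor the polynomial into linear factors.\<close>

lemma op_invertible_op_poly:
  fixes T :: "'a::complex_inner \<Rightarrow> 'a"
  assumes T: "bounded_clinear T"
  shows "q \<noteq> 0 \<Longrightarrow> (\<And>z. z \<in> op_spectrum T \<Longrightarrow> poly q z \<noteq> 0) \<Longrightarrow> op_invertible (op_poly T q)"
proof (induction "degree q" arbitrary: q)
  case 0
  then obtain a where a: "q = [:a:]" "a \<noteq> 0" by (metis degree_eq_zeroE pCons_0_0)
  show ?case unfolding op_invertible_def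
    by (rule exI[of _ "\<lambda>x. inverse a *\<^sub>C x"])
      (use a T in \<open>auto simp: fun_eq_iff scaleC_scaleC scaleC_one
        intro: bounded_clinear_scale bounded_clinear_id\<close>)
next
  case (Suc n)
  then have "\<not> constant (poly q)" by (simp add: constant_degree)
  then obtain z where z: "poly q z = 0" using fundamental_theorem_of_algebra by blast
  then obtain r where r: "q = [:- z, 1:] * r" unfolding poly_eq_0_iff_dvd dvd_def by blast
  have "r \<noteq> 0" using r Suc.prems(1) by auto
  then have "degree q = Suc (degree r)" unfolding r by (subst degree_mult_eq) auto
  moreover have "poly r w \<noteq> 0" if "w \<in> op_spectrum T" for w using Suc.prems(2)[OF that] r by auto
  ultimately have "op_invertible (op_poly T r)" using Suc \<open>r \<noteq> 0\<close> by simp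
  moreover have "op_invertible (\<lambda>x. T x - z *\<^sub>C x)"
    using Suc.prems(2)[of z] z op_spectrum_iff by blast
  ultimately have "op_invertible (\<lambda>x. T (op_poly T r x) - z *\<^sub>C op_poly T r x)"
    by (rule op_invertible_compose[rotated])
  moreover have "op_poly T q = (\<lambda>x. T (op_poly T r x) - z *\<^sub>C op_poly T r x)"
    by (rule ext) (simp only: r op_poly_mult[OF T] op_poly_linear[OF T] scaleC_minus_left, simp)
  ultimately show ?case by simp
qed

text \<open>
  For a self-adjoint operator \<open>N\<close> of norm \<open>\<mu>\<close>,
  \<open>\<parallel>N\<^sup>2 x - \<mu>\<^sup>2 x\<parallel>\<^sup>2 \<le> \<mu>\<^sup>2 (\<mu>\<^sup>2 \<parallel>x\<parallel>\<^sup>2 - \<parallel>N x\<parallel>\<^sup>2)\<close>, which is small compared with \<open>\<parallel>x\<parallel>\<^sup>2\<close> when \<open>x\<close> almost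
  attains the norm.
\<close>

lemma not_op_invertible_square_minus_norm_square:
  fixes N :: "'a::complex_inner \<Rightarrow> 'a"
  assumes N: "selfadjoint N" and nontrivial: "(e::'a) \<noteq> 0"
  shows "\<not> op_invertible (\<lambda>x. N (N x) - complex_of_real ((onorm N)\<^sup>2) *\<^sub>C x)"
proof
  let ?\<mu> = "onorm N"
  let ?S = "\<lambda>x. N (N x) - complex_of_real (?\<mu>\<^sup>2) *\<^sub>C x"
  note N' = selfadjoint_bounded_clinear[OF N]
  assume "op_invertible ?S"
  then obtain R where R: "bounded_clinear R" "\<And>x. R (?S x) = x"
    unfolding op_invertible_def by (auto simp: fun_eq_iff)
  have S_sq: "(norm (?S x))\<^sup>2 \<le> ?\<mu>\<^sup>2 * (?\<mu>\<^sup>2 * (norm x)\<^sup>2 - (norm (N x))\<^sup>2)" for x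
  proof -
    have "(norm (?S x))\<^sup>2 = Re (cinner (?S x) (?S x))" by (simp add: cinner_self)
    also have "\<dots> = (norm (N (N x)))\<^sup>2 - 2 * ?\<mu>\<^sup>2 * (norm (N x))\<^sup>2 + ?\<mu>\<^sup>2 * ?\<mu>\<^sup>2 * (norm x)\<^sup>2"
    proof -
      have 1: "cinner (N (N x)) x = of_real ((norm (N x))\<^sup>2)"
        and 2: "cinner x (N (N x)) = of_real ((norm (N x))\<^sup>2)"
        by (rule trans[OF selfadjoint_cinner[OF N] cinner_self],
            rule trans[OF selfadjoint_cinner[OF N, symmetric] cinner_self])
      have "cinner (?S x) (?S x) = of_real ((norm (N (N x)))\<^sup>2
          - 2 * ?\<mu>\<^sup>2 * (norm (N x))\<^sup>2 + ?\<mu>\<^sup>2 * ?\<mu>\<^sup>2 * (norm x)\<^sup>2)"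
        unfolding cinner_diff_left cinner_diff_right cinner_scaleC_left cinner_scaleC_right 1 2
        unfolding cinner_self by (simp add: algebra_simps)
      then show ?thesis by (simp only: Re_complex_of_real)
    qed
    also have "(norm (N (N x)))\<^sup>2 \<le> (?\<mu> * norm (N x))\<^sup>2"
      by (intro power_mono bounded_clinear_bound[OF N']) auto
    finally show ?thesis by (simp add: algebra_simps power_mult_distrib)
  qed
  define c where "c = (onorm R)\<^sup>2 * ?\<mu>\<^sup>2"
  have main: "(norm x)\<^sup>2 \<le> c * (?\<mu>\<^sup>2 * (norm x)\<^sup>2 - (norm (N x))\<^sup>2)" for x
  proof -
    have "(norm x)\<^sup>2 \<le> (onorm R * norm (?S x))\<^sup>2"
      using bounded_clinear_bound[OF R(1), of "?S x"] R(2)[of x] by (intro power_mono) auto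
    also have "\<dots> \<le> (onorm R)\<^sup>2 * (?\<mu>\<^sup>2 * (?\<mu>\<^sup>2 * (norm x)\<^sup>2 - (norm (N x))\<^sup>2))"
      unfolding power_mult_distrib by (intro mult_left_mono S_sq) simp
    finally show ?thesis by (simp add: c_def mult.assoc)
  qed
  have c: "c > 0"
  proof (rule ccontr)
    assume "\<not> c > 0"
    moreover have "c \<ge> 0" unfolding c_def by (intro mult_nonneg_nonneg zero_le_power2)
    ultimately have "c = 0" by linarith
    then show False using main[of e] nontrivial by simp
  qed
  have bound: "(norm (N x))\<^sup>2 \<le> (?\<mu>\<^sup>2 - 1 / c) * (norm x)\<^sup>2" for x
  proof -
    have "(norm x)\<^sup>2 / c \<le> ?\<mu>\<^sup>2 * (norm x)\<^sup>2 - (norm (N x))\<^sup>2"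
      using main[of x] c by (simp only: pos_divide_le_eq mult.commute)
    then show ?thesis by (simp add: left_diff_distrib)
  qed
  have nn: "0 \<le> ?\<mu>\<^sup>2 - 1 / c"
  proof -
    have "0 \<le> (?\<mu>\<^sup>2 - 1 / c) * (norm e)\<^sup>2"
      by (rule order_trans[OF zero_le_power2 bound])
    then show ?thesis using nontrivial by (simp only: zero_le_mult_iff) auto
  qed
  have "norm (N x) \<le> sqrt (?\<mu>\<^sup>2 - 1 / c) * norm x" for x
    using real_sqrt_le_mono[OF bound[of x]] by (simp add: real_sqrt_mult)
  then have "?\<mu> \<le> sqrt (?\<mu>\<^sup>2 - 1 / c)" by (intro onorm_bound real_sqrt_ge_zero nn)
  then have "?\<mu>\<^sup>2 \<le> (sqrt (?\<mu>\<^sup>2 - 1 / c))\<^sup>2" by (intro power_mono onorm_nonneg[OF N'])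
  also have "\<dots> = ?\<mu>\<^sup>2 - 1 / c" by (rule real_sqrt_pow2[OF nn])
  finally show False using c by simp
qed

lemma exists_root_in_op_spectrum:
  fixes T :: "'a::complex_inner \<Rightarrow> 'a"
  assumes T: "selfadjoint T" and nontrivial: "(e::'a) \<noteq> 0" and ninv: "\<not> op_invertible (op_poly T q)"
  shows "\<exists>z\<in>op_spectrum T. poly q z = 0"
proof (cases "q = 0")
  case False
  then show ?thesis using op_invertible_op_poly[OF selfadjoint_bounded_clinear[OF T]] ninv by blast
next
  case True
  note T' = selfadjoint_bounded_clinear[OF T]
  \<comment> \<open>The spectrum is nonempty, since it contains \<open>\<parallel>T\<parallel>\<close> or \<open>-\<parallel>T\<parallel>\<close>.\<close>
  let ?r = "[:- complex_of_real ((onorm T)\<^sup>2), 0, 1:]"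
  have "op_poly T ?r = (\<lambda>x. T (T x) - complex_of_real ((onorm T)\<^sup>2) *\<^sub>C x)"
    by (rule ext)
      (simp add: op_poly_pCons[OF T'] scaleC_minus_left scaleC_one bounded_clinear_zero[OF T'])
  then have "\<not> op_invertible (op_poly T ?r)"
    using not_op_invertible_square_minus_norm_square[OF T nontrivial] by simp
  then have "op_spectrum T \<noteq> {}" using op_invertible_op_poly[OF T', of ?r] by auto
  then show ?thesis using True by auto
qed

text \<open>
  The norm of \<open>q(T)\<close> is controlled by \<open>q\<close> on the spectrum: for \<open>N = q(T)\<^sup>* q(T)\<close>, the operator
  \<open>N\<^sup>2 - \<parallel>N\<parallel>\<^sup>2\<close> is a polynomial of \<open>T\<close> that is not invertible when the space is nonzero,
  so \<open>\<bar>q(z)\<bar>\<^sup>4 = \<parallel>N\<parallel>\<^sup>2\<close> for some \<open>z\<close> in the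
  spectrum.
\<close>

lemma norm_op_poly_le:
  fixes T :: "'a::chilbert_space \<Rightarrow> 'a"
  assumes T: "selfadjoint T" and m: "\<And>z. z \<in> op_spectrum T \<Longrightarrow> cmod (poly q z) \<le> m" "0 \<le> m"
  shows "norm (op_poly T q x) \<le> m * norm x"
proof (cases "x = 0")
  case True
  then show ?thesis
    using bounded_clinear_zero[OF bounded_clinear_op_poly[OF selfadjoint_bounded_clinear[OF T]]] by simp
next
  case False
  note T' = selfadjoint_bounded_clinear[OF T]
  define r where "r = map_poly cnj q * q"
  define N where "N = op_poly T r"
  have N_eq: "N x = op_poly T (map_poly cnj q) (op_poly T q x)" for x
    by (simp add: N_def r_def op_poly_mult[OF T'])
  have N: "selfadjoint N"
    unfolding selfadjoint_def
  proof (intro conjI allI)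
    show "bounded_clinear N" by (simp add: N_def bounded_clinear_op_poly[OF T'])
    show "cinner (N x) y = cinner x (N y)" for x y
      unfolding N_eq cinner_op_poly_cnj[OF T] by (rule cinner_op_poly[OF T])
  qed
  note N' = selfadjoint_bounded_clinear[OF N]
  let ?r = "r * r - [:complex_of_real ((onorm N)\<^sup>2):]"
  have "op_poly T ?r = (\<lambda>x. N (N x) - complex_of_real ((onorm N)\<^sup>2) *\<^sub>C x)"
    by (rule ext) (simp add: op_poly_diff[OF T'] op_poly_mult[OF T'] N_def T')
  then have "\<not> op_invertible (op_poly T ?r)"
    using not_op_invertible_square_minus_norm_square[OF N False] by simp
  then obtain z where z: "z \<in> op_spectrum T" "poly ?r z = 0"
    using exists_root_in_op_spectrum[OF T False] by blast
  have "cnj z = z" using op_spectrum_selfadjoint_real[OF T z(1)] by (simp add: complex_eq_iff)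
  then have "poly r z = of_real ((cmod (poly q z))\<^sup>2)"
    unfolding complex_norm_square r_def by simp
  then have "complex_of_real (((cmod (poly q z))\<^sup>2)\<^sup>2) = of_real ((onorm N)\<^sup>2)"
    using z(2) by (simp add: power2_eq_square)
  then have "((cmod (poly q z))\<^sup>2)\<^sup>2 = (onorm N)\<^sup>2" by (simp only: of_real_eq_iff)
  then have "onorm N = (cmod (poly q z))\<^sup>2"
    by (rule sym[OF iffD1[OF power2_eq_iff_nonneg[OF zero_le_power2 onorm_nonneg[OF N']]]])
  also have "\<dots> \<le> m\<^sup>2" by (rule power_mono[OF m(1)[OF z(1)] norm_ge_zero])
  finally have "onorm N \<le> m\<^sup>2" .
  have "(norm (op_poly T q x))\<^sup>2 = Re (cinner (op_poly T q x) (op_poly T q x))"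
    by (simp add: cinner_self)
  also have "\<dots> = Re (cinner (N x) x)" unfolding N_eq cinner_op_poly_cnj[OF T] ..
  also have "\<dots> \<le> norm (N x) * norm x" by (rule Re_cinner_le)
  also have "\<dots> \<le> (m\<^sup>2 * norm x) * norm x"
    by (rule mult_right_mono[OF order_trans[OF bounded_clinear_bound[OF N']
            mult_right_mono[OF \<open>onorm N \<le> m\<^sup>2\<close> norm_ge_zero]] norm_ge_zero])
  also have "\<dots> = (m * norm x)\<^sup>2" by (simp add: power2_eq_square)
  finally have "(norm (op_poly T q x))\<^sup>2 \<le> (m * norm x)\<^sup>2" .
  then show ?thesis by (rule power2_le_imp_le) (intro mult_nonneg_nonneg m(2) norm_ge_zero)
qed

section \<open>The continuous functional calculus\<close>

lemma exists_pos_mult_less: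
  fixes c e :: real
  assumes e: "e > 0" and c: "c \<ge> 0"
  shows "\<exists>d>0. d * c < e"
proof (intro exI conjI)
  show "e / (c + 1) > 0" using e c by simp
  have "e * c < e * (c + 1)" using e by simp
  then show "e / (c + 1) * c < e" using c by (simp add: pos_divide_less_eq)
qed

lemma poly_add_fun: "poly (p + q) = (\<lambda>z. poly p z + poly q z)"
  and poly_mult_fun: "poly (p * q) = (\<lambda>z. poly p z * poly q z)"
  by (simp_all add: fun_eq_iff)

lemma exists_poly_approx_real:
  assumes "compact K" "continuous_on K u" "e > 0"
  obtains q where "\<And>t. t \<in> K \<Longrightarrow> cmod (poly q (complex_of_real t) - complex_of_real (u t)) < e"
proof -
  obtain g where g: "real_polynomial_function g" "\<And>t. t \<in> K \<Longrightarrow> \<bar>u t - g t\<bar> < e"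
    using Stone_Weierstrass_real_polynomial_function[OF assms] by blast
  obtain a n where a: "g = (\<lambda>x. \<Sum>i\<le>n. a i * x ^ i)"
    using g(1) unfolding real_polynomial_function_iff_sum by blast
  define q where "q = (\<Sum>i\<le>n. monom (complex_of_real (a i)) i)"
  have q: "poly q (of_real t) = of_real (g t)" for t
    by (simp add: q_def a poly_sum poly_monom)
  show ?thesis
  proof
    fix t assume "t \<in> K"
    then show "cmod (poly q (complex_of_real t) - complex_of_real (u t)) < e"
      using g(2)[of t] by (simp add: q abs_minus_commute flip: of_real_diff)
  qed
qed

lemma exists_poly_seq:
  fixes T :: "'a::chilbert_space \<Rightarrow> 'a"
  assumes T: "selfadjoint T" and h: "continuous_on (op_spectrum T) h"
  shows "\<exists>q. uniform_limit (op_spectrum T) (\<lambda>n. poly (q n)) h sequentially"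
proof -
  let ?\<sigma> = "op_spectrum T" and ?K = "Re ` op_spectrum T"
  have K: "compact ?K"
    by (intro compact_continuous_image compact_op_spectrum selfadjoint_bounded_clinear[OF T]
        continuous_intros)
  have hK: "continuous_on ?K (\<lambda>t. h (of_real t))"
    by (rule continuous_on_compose2[OF h])
      (auto intro!: continuous_intros simp: op_spectrum_selfadjoint_of_real[OF T])
  have "\<exists>q. \<forall>z\<in>?\<sigma>. cmod (poly q z - h z) < e" if e: "e > 0" for e
  proof -
    obtain q where q: "\<And>t. t \<in> ?K \<Longrightarrow> cmod (poly q (of_real t) - of_real (Re (h (of_real t)))) < e / 2"
      using exists_poly_approx_real[OF K continuous_on_Re[OF hK] half_gt_zero[OF e]] by blast
    obtain r where r: "\<And>t. t \<in> ?K \<Longrightarrow> cmod (poly r (of_real t) - of_real (Im (h (of_real t)))) < e / 2"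
      using exists_poly_approx_real[OF K continuous_on_Im[OF hK] half_gt_zero[OF e]] by blast
    have "cmod (poly (q + smult \<i> r) z - h z) < e" if z: "z \<in> ?\<sigma>" for z
    proof -
      let ?a = "poly q z - of_real (Re (h z))" and ?b = "poly r z - of_real (Im (h z))"
      have "poly (q + smult \<i> r) z - h z = ?a + \<i> * ?b"
        by (subst complex_eq[of "h z"]) (simp add: algebra_simps)
      then have "cmod (poly (q + smult \<i> r) z - h z) \<le> cmod ?a + cmod ?b"
        by (metis norm_triangle_ineq norm_mult norm_ii mult_1)
      moreover have "cmod ?a < e / 2" "cmod ?b < e / 2"
        using q[of "Re z"] r[of "Re z"] z by (auto simp: op_spectrum_selfadjoint_of_real[OF T])
      ultimately show ?thesis by simp
    qed
    then show ?thesis by blast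
  qed
  then have "\<forall>n. \<exists>q. \<forall>z\<in>?\<sigma>. cmod (poly q z - h z) < inverse (real (Suc n))"
    by (metis inverse_positive_iff_positive of_nat_0_less_iff zero_less_Suc)
  then obtain q where q: "\<And>n z. z \<in> ?\<sigma> \<Longrightarrow> cmod (poly (q n) z - h z) < inverse (real (Suc n))"
    by metis
  have "uniform_limit ?\<sigma> (\<lambda>n. poly (q n)) h sequentially"
  proof (rule uniform_limitI)
    fix e :: real assume "e > 0"
    then have "\<forall>\<^sub>F n in sequentially. inverse (real (Suc n)) < e"
      using LIMSEQ_inverse_real_of_nat order_tendstoD(2) by blast
    then show "\<forall>\<^sub>F n in sequentially. \<forall>z\<in>?\<sigma>. dist (poly (q n) z) (h z) < e"
      by eventually_elim (use q in \<open>auto simp: dist_norm intro: less_trans\<close>)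
  qed
  then show ?thesis by blast
qed

text \<open>
  The extension of \<open>q \<mapsto> q(T)\<close> from polynomials to continuous functions.  Any sequence converging to
  \<open>h\<close> uniformly on the spectrum gives the same limit, so the choice is immaterial.
\<close>

definition calc ::
    "('a::complex_inner \<Rightarrow> 'a) \<Rightarrow> (complex \<Rightarrow> complex) \<Rightarrow> 'a \<Rightarrow> 'a" where
  "calc T h x = lim (\<lambda>n. op_poly T
     ((SOME q. uniform_limit (op_spectrum T) (\<lambda>n. poly (q n)) h sequentially) n) x)"

text \<open>The norm bound for polynomials makes the operators \<open>q\<^sub>n(T)\<close> a Cauchy sequence, and makes two sequences
  with the same uniform limit asymptotically equal.\<close>

lemma calc_tendsto:
  fixes T :: "'a::chilbert_space \<Rightarrow> 'a"
  assumes T: "selfadjoint T"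
    and q: "uniform_limit (op_spectrum T) (\<lambda>n. poly (q n)) h sequentially"
  shows "(\<lambda>n. op_poly T (q n) x) \<longlonglongrightarrow> calc T h x"
proof -
  let ?\<sigma> = "op_spectrum T"
  note T' = selfadjoint_bounded_clinear[OF T]
  have close: "\<exists>N. \<forall>m\<ge>N. \<forall>n\<ge>N. dist (op_poly T (r m) x) (op_poly T (s n) x) < e"
    if r: "uniform_limit ?\<sigma> (\<lambda>n. poly (r n)) h sequentially"
      and s: "uniform_limit ?\<sigma> (\<lambda>n. poly (s n)) h sequentially" and e: "e > 0" for r s e
  proof -
    obtain d where d: "d > 0" "d * norm x < e"
      using exists_pos_mult_less[OF e norm_ge_zero] by blast
    obtain M where M: "\<And>n z. n \<ge> M \<Longrightarrow> z \<in> ?\<sigma> \<Longrightarrow> dist (poly (r n) z) (h z) < d / 2"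
      using uniform_limitD[OF r, of "d / 2"] d by (auto simp: eventually_sequentially)
    obtain M' where M': "\<And>n z. n \<ge> M' \<Longrightarrow> z \<in> ?\<sigma> \<Longrightarrow> dist (poly (s n) z) (h z) < d / 2"
      using uniform_limitD[OF s, of "d / 2"] d by (auto simp: eventually_sequentially)
    show ?thesis
    proof (intro exI allI impI)
      fix m n assume mn: "m \<ge> max M M'" "n \<ge> max M M'"
      have "cmod (poly (r m - s n) z) \<le> d" if "z \<in> ?\<sigma>" for z
        using M[of m z] M'[of n z] mn that dist_triangle2[of "poly (r m) z" "poly (s n) z" "h z"]
        by (simp add: dist_norm)
      then have "norm (op_poly T (r m - s n) x) \<le> d * norm x"
        using d by (intro norm_op_poly_le[OF T]) auto
      then show "dist (op_poly T (r m) x) (op_poly T (s n) x) < e"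
        using d by (simp add: op_poly_diff[OF T'] dist_norm)
    qed
  qed
  define r where "r = (SOME q. uniform_limit ?\<sigma> (\<lambda>n. poly (q n)) h sequentially)"
  have r: "uniform_limit ?\<sigma> (\<lambda>n. poly (r n)) h sequentially"
    unfolding r_def
    by (rule someI[where P = "\<lambda>q. uniform_limit ?\<sigma> (\<lambda>n. poly (q n)) h sequentially", OF q])
  have "Cauchy (\<lambda>n. op_poly T (r n) x)"
    using close[OF r r] by (auto simp: Cauchy_def)
  then have lim: "(\<lambda>n. op_poly T (r n) x) \<longlonglongrightarrow> calc T h x"
    unfolding calc_def r_def[symmetric] by (simp add: Cauchy_convergent_iff convergent_LIMSEQ_iff)
  have "(\<lambda>n. op_poly T (q n) x - op_poly T (r n) x) \<longlonglongrightarrow> 0"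
    unfolding lim_sequentially using close[OF q r] by (fastforce simp: dist_norm)
  from tendsto_add[OF this lim] show ?thesis by simp
qed

lemma cinner_eq_inner:
  "cinner x y = complex_of_real (inner x y) + \<i> * complex_of_real (inner x (\<i> *\<^sub>C y))"
  by (simp add: complex_eq_iff inner_eq_Re_cinner cinner_scaleC_right)

lemma tendsto_cinner_left:
  assumes "(s \<longlongrightarrow> l) F"
  shows "((\<lambda>n. cinner (s n) y) \<longlongrightarrow> cinner l y) F"
  unfolding cinner_eq_inner[of _ y] by (intro tendsto_intros assms)

lemma tendsto_cinner_right:
  assumes "(s \<longlongrightarrow> l) F"
  shows "((\<lambda>n. cinner x (s n)) \<longlongrightarrow> cinner x l) F"
  using tendsto_cnj[OF tendsto_cinner_left[OF assms, of x]] by (simp flip: cinner_commute)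

lemma bounded_on_op_spectrum:
  fixes T :: "'a::chilbert_space \<Rightarrow> 'a" and h :: "complex \<Rightarrow> complex"
  assumes T: "bounded_clinear T" and h: "continuous_on (op_spectrum T) h"
  shows "bounded (h ` op_spectrum T)"
  by (intro compact_imp_bounded compact_continuous_image compact_op_spectrum assms)

lemma norm_calc_le:
  fixes T :: "'a::chilbert_space \<Rightarrow> 'a"
  assumes T: "selfadjoint T" and h: "continuous_on (op_spectrum T) h"
    and m: "\<And>z. z \<in> op_spectrum T \<Longrightarrow> cmod (h z) \<le> m" "0 \<le> m"
  shows "norm (calc T h x) \<le> m * norm x"
proof -
  obtain q where q: "uniform_limit (op_spectrum T) (\<lambda>n. poly (q n)) h sequentially"
    using exists_poly_seq[OF T h] by blast
  have le: "norm (calc T h x) \<le> (m + e) * norm x" if e: "e > 0" for e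
  proof (rule tendsto_upperbound[OF tendsto_norm[OF calc_tendsto[OF T q]]])
    show "\<forall>\<^sub>F n in sequentially. norm (op_poly T (q n) x) \<le> (m + e) * norm x"
      using uniform_limitD[OF q e]
    proof eventually_elim
      case (elim n)
      have "cmod (poly (q n) z) \<le> m + e" if "z \<in> op_spectrum T" for z
        using elim that m(1)[OF that] norm_triangle_ineq2[of "poly (q n) z" "h z"]
        by (force simp: dist_norm)
      then show ?case using m(2) e by (intro norm_op_poly_le[OF T]) auto
    qed
  qed simp
  show ?thesis
  proof (rule field_le_epsilon)
    fix e :: real assume e: "e > 0"
    obtain d where d: "d > 0" "d * norm x < e"
      using exists_pos_mult_less[OF e norm_ge_zero] by blast
    show "norm (calc T h x) \<le> m * norm x + e"
      using le[OF d(1)] d(2) by (simp add: distrib_right)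
  qed
qed

lemma calc_poly:
  fixes T :: "'a::chilbert_space \<Rightarrow> 'a"
  assumes "selfadjoint T"
  shows "calc T (poly q) = op_poly T q"
proof
  fix x
  have "(\<lambda>n. op_poly T q x) \<longlonglongrightarrow> calc T (poly q) x"
    by (rule calc_tendsto[OF assms]) (rule uniform_limit_const)
  then show "calc T (poly q) x = op_poly T q x" by (simp add: LIMSEQ_const_iff)
qed

lemma calc_cong:
  fixes T :: "'a::chilbert_space \<Rightarrow> 'a"
  assumes T: "selfadjoint T" and h: "continuous_on (op_spectrum T) h"
    and eq: "\<And>z. z \<in> op_spectrum T \<Longrightarrow> h z = k z"
  shows "calc T h = calc T k"
proof
  fix x
  obtain q where q: "uniform_limit (op_spectrum T) (\<lambda>n. poly (q n)) h sequentially"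
    using exists_poly_seq[OF T h] by blast
  moreover from q have "uniform_limit (op_spectrum T) (\<lambda>n. poly (q n)) k sequentially"
    by (subst (asm) uniform_limit_cong') (auto simp: eq)
  ultimately show "calc T h x = calc T k x" using calc_tendsto[OF T] LIMSEQ_unique by blast
qed

lemma bounded_clinear_calc:
  fixes T :: "'a::chilbert_space \<Rightarrow> 'a"
  assumes T: "selfadjoint T" and h: "continuous_on (op_spectrum T) h"
  shows "bounded_clinear (calc T h)"
proof -
  note T' = selfadjoint_bounded_clinear[OF T]
  obtain q where q: "uniform_limit (op_spectrum T) (\<lambda>n. poly (q n)) h sequentially"
    using exists_poly_seq[OF T h] by blast
  note lim = calc_tendsto[OF T q]
  obtain m where m: "\<And>z. z \<in> op_spectrum T \<Longrightarrow> cmod (h z) \<le> m" "m > 0"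
    using bounded_on_op_spectrum[OF T' h] by (auto simp: bounded_pos)
  show ?thesis
  proof (rule bounded_clinearI)
    fix x y c
    have "(\<lambda>n. op_poly T (q n) (x + y)) \<longlonglongrightarrow> calc T h x + calc T h y"
      unfolding bounded_clinear_add[OF bounded_clinear_op_poly[OF T']] by (intro tendsto_add lim)
    then show "calc T h (x + y) = calc T h x + calc T h y" using lim LIMSEQ_unique by blast
    have scale: "bounded_linear (\<lambda>x::'a. c *\<^sub>C x)"
      by (intro bounded_clinear_imp_bounded_linear bounded_clinear_scale bounded_clinear_id)
    have "(\<lambda>n. op_poly T (q n) (c *\<^sub>C x)) \<longlonglongrightarrow> c *\<^sub>C calc T h x"
      unfolding bounded_clinear_scaleC[OF bounded_clinear_op_poly[OF T']]
      by (rule bounded_linear.tendsto[OF scale lim])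
    then show "calc T h (c *\<^sub>C x) = c *\<^sub>C calc T h x" using lim LIMSEQ_unique by blast
    show "norm (calc T h x) \<le> m * norm x" using m by (intro norm_calc_le[OF T h]) auto
  qed
qed

lemma is_functional_calculus_calc:
  fixes T :: "'a::chilbert_space \<Rightarrow> 'a"
  assumes T: "selfadjoint T"
  shows "is_functional_calculus T (calc T)"
proof -
  let ?\<sigma> = "op_spectrum T"
  note T' = selfadjoint_bounded_clinear[OF T]
  have add: "calc T (\<lambda>z. h z + k z) = (\<lambda>x. calc T h x + calc T k x)"
    if hk: "continuous_on ?\<sigma> h" "continuous_on ?\<sigma> k" for h k
  proof
    fix x
    obtain q r where q: "uniform_limit ?\<sigma> (\<lambda>n. poly (q n)) h sequentially"
      and r: "uniform_limit ?\<sigma> (\<lambda>n. poly (r n)) k sequentially"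
      using hk exists_poly_seq[OF T] by blast
    have "uniform_limit ?\<sigma> (\<lambda>n. poly (q n + r n)) (\<lambda>z. h z + k z) sequentially"
      using uniform_limit_add[OF q r] by (simp only: poly_add_fun)
    from calc_tendsto[OF T this, of x]
    have "(\<lambda>n. op_poly T (q n) x + op_poly T (r n) x) \<longlonglongrightarrow> calc T (\<lambda>z. h z + k z) x"
      by (simp add: op_poly_add[OF T'])
    from LIMSEQ_unique[OF this tendsto_add[OF calc_tendsto[OF T q] calc_tendsto[OF T r]]]
    show "calc T (\<lambda>z. h z + k z) x = calc T h x + calc T k x" .
  qed
  have mult: "calc T (\<lambda>z. h z * k z) = calc T h \<circ> calc T k"
    if hk: "continuous_on ?\<sigma> h" "continuous_on ?\<sigma> k" for h k
  proof
    fix x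
    obtain q r where q: "uniform_limit ?\<sigma> (\<lambda>n. poly (q n)) h sequentially"
      and r: "uniform_limit ?\<sigma> (\<lambda>n. poly (r n)) k sequentially"
      using hk exists_poly_seq[OF T] by blast
    have "uniform_limit ?\<sigma> (\<lambda>n. poly (q n * r n)) (\<lambda>z. h z * k z) sequentially"
      using uniform_lim_mult[OF q r] bounded_on_op_spectrum[OF T'] hk
      by (simp only: poly_mult_fun)
    from calc_tendsto[OF T this, of x]
    have 1: "(\<lambda>n. op_poly T (q n) (op_poly T (r n) x)) \<longlonglongrightarrow> calc T (\<lambda>z. h z * k z) x"
      by (simp add: op_poly_mult[OF T'])
    let ?y = "calc T k x"
    have y: "(\<lambda>n. op_poly T (r n) x - ?y) \<longlonglongrightarrow> 0"
      using tendsto_diff[OF calc_tendsto[OF T r, of x] tendsto_const[of ?y]] by simp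
    obtain m where m: "\<And>z. z \<in> ?\<sigma> \<Longrightarrow> cmod (h z) \<le> m" "m > 0"
      using bounded_on_op_spectrum[OF T' hk(1)] by (auto simp: bounded_pos)
    have "(\<lambda>n. op_poly T (q n) (op_poly T (r n) x - ?y)) \<longlonglongrightarrow> 0"
    proof (rule Lim_null_comparison)
      show "\<forall>\<^sub>F n in sequentially. norm (op_poly T (q n) (op_poly T (r n) x - ?y))
          \<le> (m + 1) * norm (op_poly T (r n) x - ?y)"
        using uniform_limitD[OF q zero_less_one]
      proof eventually_elim
        case (elim n)
        have "cmod (poly (q n) z) \<le> m + 1" if "z \<in> ?\<sigma>" for z
          using elim that m(1)[OF that] norm_triangle_ineq2[of "poly (q n) z" "h z"]
          by (force simp: dist_norm)
        then show ?case using m(2) by (intro norm_op_poly_le[OF T]) auto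
      qed
      show "(\<lambda>n. (m + 1) * norm (op_poly T (r n) x - ?y)) \<longlonglongrightarrow> 0"
        using tendsto_mult[OF tendsto_const tendsto_norm[OF y], of "m + 1"] by simp
    qed
    from tendsto_add[OF this calc_tendsto[OF T q, of ?y]]
    have "(\<lambda>n. op_poly T (q n) (op_poly T (r n) x)) \<longlonglongrightarrow> calc T h ?y"
      by (simp add: bounded_clinear_diff[OF bounded_clinear_op_poly[OF T']])
    from LIMSEQ_unique[OF 1 this] show "calc T (\<lambda>z. h z * k z) x = (calc T h \<circ> calc T k) x"
      by simp
  qed
  have cnj: "calc T (\<lambda>z. cnj (h z)) = (calc T h)\<^sup>\<dagger>" if h: "continuous_on ?\<sigma> h" for h
  proof (rule cadjoint_eqI[symmetric])
    fix x y
    obtain q where q: "uniform_limit ?\<sigma> (\<lambda>n. poly (q n)) h sequentially"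
      using h exists_poly_seq[OF T] by blast
    have cnj_z: "cnj z = z" if "z \<in> ?\<sigma>" for z
      using op_spectrum_selfadjoint_real[OF T that] by (simp add: complex_eq_iff)
    have "uniform_limit ?\<sigma> (\<lambda>n. poly (map_poly cnj (q n))) (\<lambda>z. cnj (h z)) sequentially"
      using q unfolding uniform_limit_iff
      by (simp add: cnj_z dist_norm flip: complex_cnj_diff cong: ball_cong)
    from tendsto_cinner_right[OF calc_tendsto[OF T this, of y], of x]
    have "(\<lambda>n. cinner (op_poly T (q n) x) y) \<longlonglongrightarrow> cinner x (calc T (\<lambda>z. cnj (h z)) y)"
      by (simp add: cinner_op_poly[OF T])
    from LIMSEQ_unique[OF tendsto_cinner_left[OF calc_tendsto[OF T q]] this]
    show "cinner (calc T h x) y = cinner x (calc T (\<lambda>z. cnj (h z)) y)" .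
  qed
  have one: "calc T (\<lambda>_. 1) = id"
    using calc_poly[OF T, of 1] T' by (simp add: fun_eq_iff poly_1[abs_def])
  have ident: "calc T (\<lambda>z. z) = T"
    using calc_poly[OF T, of "[:0, 1:]"]
    by (simp add: fun_eq_iff op_poly_linear[OF T'] poly_pCons[abs_def])
  have const: "calc T (\<lambda>z. c) = (\<lambda>x. c *\<^sub>C x)" for c
    using calc_poly[OF T, of "[:c:]"] T' by (simp add: fun_eq_iff poly_pCons[abs_def])
  have scale: "calc T (\<lambda>z. c * h z) = (\<lambda>x. c *\<^sub>C calc T h x)" if "continuous_on ?\<sigma> h" for c h
    unfolding mult[OF continuous_on_const that] const by (simp add: fun_eq_iff)
  show ?thesis
    unfolding is_functional_calculus_def Let_def
  proof (intro conjI ballI allI impI)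
    fix h k :: "complex \<Rightarrow> complex" assume "h \<in> {h. continuous_on ?\<sigma> h}" and "\<forall>z\<in>?\<sigma>. h z = k z"
    then show "calc T h = calc T k" by (intro calc_cong[OF T]) auto
  qed (simp_all add: scale, simp_all add: add mult cnj one ident bounded_clinear_calc[OF T])
qed

lemma
  assumes "is_functional_calculus T \<Phi>"
  shows functional_calculus_bounded_clinear:
      "continuous_on (op_spectrum T) h \<Longrightarrow> bounded_clinear (\<Phi> h)"
    and functional_calculus_cong:
      "continuous_on (op_spectrum T) h \<Longrightarrow> continuous_on (op_spectrum T) k \<Longrightarrow>
        (\<And>z. z \<in> op_spectrum T \<Longrightarrow> h z = k z) \<Longrightarrow> \<Phi> h = \<Phi> k"
    and functional_calculus_add:
      "continuous_on (op_spectrum T) h \<Longrightarrow> continuous_on (op_spectrum T) k \<Longrightarrow>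
        \<Phi> (\<lambda>z. h z + k z) = (\<lambda>x. \<Phi> h x + \<Phi> k x)"
    and functional_calculus_scale:
      "continuous_on (op_spectrum T) h \<Longrightarrow> \<Phi> (\<lambda>z. c * h z) = (\<lambda>x. c *\<^sub>C \<Phi> h x)"
    and functional_calculus_mult:
      "continuous_on (op_spectrum T) h \<Longrightarrow> continuous_on (op_spectrum T) k \<Longrightarrow>
        \<Phi> (\<lambda>z. h z * k z) = \<Phi> h \<circ> \<Phi> k"
    and functional_calculus_cnj:
      "continuous_on (op_spectrum T) h \<Longrightarrow> \<Phi> (\<lambda>z. cnj (h z)) = (\<Phi> h)\<^sup>\<dagger>"
    and functional_calculus_one: "\<Phi> (\<lambda>_. 1) = id"
    and functional_calculus_ident: "\<Phi> (\<lambda>z. z) = T"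
  using assms unfolding is_functional_calculus_def Let_def by blast+

lemma functional_calculus_const:
  assumes "is_functional_calculus T \<Phi>"
  shows "\<Phi> (\<lambda>_. c) = (\<lambda>x. c *\<^sub>C x)"
  using functional_calculus_scale[OF assms continuous_on_const[of _ 1], of c]
  by (simp add: functional_calculus_one[OF assms])

lemma functional_calculus_poly:
  assumes T: "bounded_clinear T" and \<Phi>: "is_functional_calculus T \<Phi>"
  shows "\<Phi> (poly q) = op_poly T q"
proof (induction q)
  case 0
  then show ?case using functional_calculus_const[OF \<Phi>, of 0] by (simp add: fun_eq_iff)
next
  case (pCons a q)
  have "\<Phi> (\<lambda>z. a + z * poly q z) = (\<lambda>x. a *\<^sub>C x + T (op_poly T q x))"
    unfolding functional_calculus_add[OF \<Phi> continuous_on_const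
        continuous_on_mult[OF continuous_on_id continuous_on_poly[OF continuous_on_id]]]
      functional_calculus_mult[OF \<Phi> continuous_on_id continuous_on_poly[OF continuous_on_id]]
      functional_calculus_const[OF \<Phi>] functional_calculus_ident[OF \<Phi>]
    by (simp add: pCons)
  then show ?case by (simp add: fun_eq_iff op_poly_pCons[OF T] poly_pCons[abs_def])
qed

text \<open>
  A *-homomorphism is contractive: if \<open>\<bar>h\<bar> \<le> m\<close> then \<open>m\<^sup>2 - \<bar>h\<bar>\<^sup>2\<close> is the square of a real continuous
  function \<open>k\<close>, and \<open>m\<^sup>2 \<parallel>x\<parallel>\<^sup>2 - \<parallel>\<Phi>(h) x\<parallel>\<^sup>2 = \<parallel>\<Phi>(k) x\<parallel>\<^sup>2\<close>.
\<close>

lemma functional_calculus_norm_le: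
  fixes T :: "'a::chilbert_space \<Rightarrow> 'a"
  assumes \<Phi>: "is_functional_calculus T \<Phi>" and h: "continuous_on (op_spectrum T) h"
    and m: "\<And>z. z \<in> op_spectrum T \<Longrightarrow> cmod (h z) \<le> m" "0 \<le> m"
  shows "norm (\<Phi> h x) \<le> m * norm x"
proof -
  let ?\<sigma> = "op_spectrum T"
  define k where "k = (\<lambda>z. complex_of_real (sqrt (m\<^sup>2 - (cmod (h z))\<^sup>2)))"
  have k: "continuous_on ?\<sigma> k" unfolding k_def by (intro continuous_intros h)
  have sq: "cnj (u z) * u z = of_real ((cmod (u z))\<^sup>2)" for u :: "complex \<Rightarrow> complex" and z
    by (metis complex_norm_square mult.commute)
  have norm_sq: "cinner (\<Phi> (\<lambda>z. cnj (u z) * u z) x) x = of_real ((norm (\<Phi> u x))\<^sup>2)"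
    if u: "continuous_on ?\<sigma> u" for u
  proof -
    have "\<Phi> (\<lambda>z. cnj (u z) * u z) = (\<Phi> u)\<^sup>\<dagger> \<circ> \<Phi> u"
      using u by (subst functional_calculus_mult[OF \<Phi>])
        (auto intro!: continuous_intros simp: functional_calculus_cnj[OF \<Phi>])
    then show ?thesis
      by (simp add: cinner_cadjoint_left functional_calculus_bounded_clinear[OF \<Phi> u] cinner_self)
  qed
  have "cnj (h z) * h z + cnj (k z) * k z = of_real (m\<^sup>2)" if "z \<in> ?\<sigma>" for z
  proof -
    have "(cmod (k z))\<^sup>2 = m\<^sup>2 - (cmod (h z))\<^sup>2"
      using m(1)[OF that] by (simp add: k_def power_mono)
    then show ?thesis unfolding sq by (simp flip: of_real_add)
  qed
  then have "\<Phi> (\<lambda>z. cnj (h z) * h z + cnj (k z) * k z) = \<Phi> (\<lambda>_. of_real (m\<^sup>2))"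
    by (intro functional_calculus_cong[OF \<Phi>] continuous_intros h k)
  then have "(\<lambda>x. \<Phi> (\<lambda>z. cnj (h z) * h z) x + \<Phi> (\<lambda>z. cnj (k z) * k z) x) = (\<lambda>x. of_real (m\<^sup>2) *\<^sub>C x)"
    by (subst (asm) functional_calculus_add[OF \<Phi>])
      (auto intro!: continuous_intros h k simp: functional_calculus_const[OF \<Phi>])
  then have "cinner (\<Phi> (\<lambda>z. cnj (h z) * h z) x + \<Phi> (\<lambda>z. cnj (k z) * k z) x) x =
      cinner (complex_of_real (m\<^sup>2) *\<^sub>C x) x"
    by (rule arg_cong[where f = "\<lambda>F. cinner (F x) x"])
  then have "complex_of_real ((norm (\<Phi> h x))\<^sup>2 + (norm (\<Phi> k x))\<^sup>2) = of_real ((m * norm x)\<^sup>2)"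
    by (simp add: cinner_add_left norm_sq h k cinner_scaleC_left cinner_self power_mult_distrib)
  then have "(norm (\<Phi> h x))\<^sup>2 + (norm (\<Phi> k x))\<^sup>2 = (m * norm x)\<^sup>2"
    by (simp only: of_real_eq_iff)
  then have "(norm (\<Phi> h x))\<^sup>2 \<le> (m * norm x)\<^sup>2"
    using zero_le_power2[of "norm (\<Phi> k x)"] by linarith
  then show ?thesis by (rule power2_le_imp_le) (intro mult_nonneg_nonneg m(2) norm_ge_zero)
qed

text \<open>A functional calculus sends polynomials to polynomials of \<open>T\<close>, and contractivity carries this over to
  uniform limits.\<close>

lemma functional_calculus_unique:
  fixes T :: "'a::chilbert_space \<Rightarrow> 'a"
  assumes T: "selfadjoint T" and \<Phi>: "is_functional_calculus T \<Phi>"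
    and h: "continuous_on (op_spectrum T) h"
  shows "\<Phi> h = calc T h"
proof
  fix x
  let ?\<sigma> = "op_spectrum T"
  obtain q where q: "uniform_limit ?\<sigma> (\<lambda>n. poly (q n)) h sequentially"
    using exists_poly_seq[OF T h] by blast
  have "(\<lambda>n. op_poly T (q n) x) \<longlonglongrightarrow> \<Phi> h x"
  proof (rule metric_LIMSEQ_I)
    fix e :: real assume e: "e > 0"
    obtain d where d: "d > 0" "d * norm x < e"
      using exists_pos_mult_less[OF e norm_ge_zero] by blast
    have "dist (op_poly T (q n) x) (\<Phi> h x) < e" if n: "\<forall>z\<in>?\<sigma>. dist (poly (q n) z) (h z) < d" for n
    proof -
      have "norm (\<Phi> (\<lambda>z. poly (q n) z + (- 1) * h z) x) \<le> d * norm x"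
        using n d by (intro functional_calculus_norm_le[OF \<Phi>] continuous_intros h)
          (auto simp: dist_norm less_imp_le)
      also have "\<Phi> (\<lambda>z. poly (q n) z + (- 1) * h z) = (\<lambda>x. op_poly T (q n) x + (- 1) *\<^sub>C \<Phi> h x)"
        unfolding functional_calculus_add[OF \<Phi> continuous_on_poly[OF continuous_on_id]
            continuous_on_mult[OF continuous_on_const h]]
          functional_calculus_scale[OF \<Phi> h]
        using functional_calculus_poly[OF selfadjoint_bounded_clinear[OF T] \<Phi>, of "q n"]
        by (simp add: fun_eq_iff)
      finally show ?thesis using d by (simp add: dist_norm scaleC_minus_left scaleC_one)
    qed
    then show "\<exists>N. \<forall>n\<ge>N. dist (op_poly T (q n) x) (\<Phi> h x) < e"
      using uniform_limitD[OF q d(1)] unfolding eventually_sequentially by blast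
  qed
  then show "\<Phi> h x = calc T h x" using calc_tendsto[OF T q] LIMSEQ_unique by blast
qed

section \<open>Functions of a positive operator\<close>

lemma continuous_on_op_spectrum_of_real:
  fixes T :: "'a::chilbert_space \<Rightarrow> 'a" and h :: "real \<Rightarrow> real"
  assumes T: "positive_op T" and h: "continuous_on {0..} h"
  shows "continuous_on (op_spectrum T) (\<lambda>z. complex_of_real (h (Re z)))"
proof -
  have "continuous_on (op_spectrum T) (\<lambda>z. h (Re z))"
    by (rule continuous_on_compose2[OF h])
      (auto intro!: continuous_intros op_spectrum_positive[OF T])
  then show ?thesis by (rule continuous_on_of_real)
qed

text \<open>Existence and uniqueness of the functional calculus make the description defining \<open>op_fun\<close> proper;
  any functional calculus may then be used to evaluate it.\<close>

lemma op_fun_eqI: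
  fixes T :: "'a::chilbert_space \<Rightarrow> 'a"
  assumes T: "positive_op T" and h: "continuous_on {0..} h" and \<Phi>: "is_functional_calculus T \<Phi>"
  shows "op_fun h T = \<Phi> (\<lambda>z. complex_of_real (h (Re z)))"
proof -
  note T' = positive_op_selfadjoint[OF T]
  note h' = continuous_on_op_spectrum_of_real[OF T h]
  show ?thesis
    unfolding op_fun_def
  proof (rule the_equality)
    fix R
    assume "\<exists>\<Psi>. is_functional_calculus T \<Psi> \<and> R = \<Psi> (\<lambda>z. complex_of_real (h (Re z)))"
    then show "R = \<Phi> (\<lambda>z. complex_of_real (h (Re z)))"
      using functional_calculus_unique[OF T' _ h'] \<Phi> by auto
  qed (use \<Phi> in blast)
qed

lemma op_fun_eq_calc:
  fixes T :: "'a::chilbert_space \<Rightarrow> 'a"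
  assumes "positive_op T" "continuous_on {0..} h"
  shows "op_fun h T = calc T (\<lambda>z. complex_of_real (h (Re z)))"
  using assms by (intro op_fun_eqI is_functional_calculus_calc positive_op_selfadjoint)

lemma op_fun_cong:
  fixes T :: "'a::chilbert_space \<Rightarrow> 'a"
  assumes T: "positive_op T" and h: "continuous_on {0..} h" and eq: "\<And>t. t \<ge> 0 \<Longrightarrow> h t = k t"
  shows "op_fun h T = op_fun k T"
proof -
  have k: "continuous_on {0..} k" using h by (rule continuous_on_eq) (simp add: eq)
  show ?thesis
    unfolding op_fun_eq_calc[OF T h] op_fun_eq_calc[OF T k]
    by (intro calc_cong[OF positive_op_selfadjoint[OF T]] continuous_on_op_spectrum_of_real T h)
      (simp add: eq op_spectrum_positive[OF T])
qed

lemma op_fun_const: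
  fixes T :: "'a::chilbert_space \<Rightarrow> 'a"
  assumes T: "positive_op T"
  shows "op_fun (\<lambda>_. c) T = (\<lambda>x. complex_of_real c *\<^sub>C x)"
  using functional_calculus_const[OF is_functional_calculus_calc[OF positive_op_selfadjoint[OF T]]]
  by (simp add: op_fun_eq_calc[OF T])

lemma op_fun_ident:
  fixes T :: "'a::chilbert_space \<Rightarrow> 'a"
  assumes T: "positive_op T"
  shows "op_fun (\<lambda>t. t) T = T"
proof -
  note T' = positive_op_selfadjoint[OF T]
  have "op_fun (\<lambda>t. t) T = calc T (\<lambda>z. complex_of_real (Re z))"
    by (intro op_fun_eq_calc T continuous_intros)
  also have "\<dots> = calc T (\<lambda>z. z)"
    by (intro calc_cong[OF T'] continuous_intros op_spectrum_selfadjoint_of_real[OF T'])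
  finally show ?thesis
    by (simp add: functional_calculus_ident[OF is_functional_calculus_calc[OF T']])
qed

lemma op_fun_add:
  fixes T :: "'a::chilbert_space \<Rightarrow> 'a"
  assumes T: "positive_op T" and h: "continuous_on {0..} h" and k: "continuous_on {0..} k"
  shows "op_fun (\<lambda>t. h t + k t) T x = op_fun h T x + op_fun k T x"
  using functional_calculus_add[OF is_functional_calculus_calc[OF positive_op_selfadjoint[OF T]]
      continuous_on_op_spectrum_of_real[OF T h] continuous_on_op_spectrum_of_real[OF T k]]
  unfolding op_fun_eq_calc[OF T h] op_fun_eq_calc[OF T k]
    op_fun_eq_calc[OF T continuous_on_add[OF h k]] of_real_add
  by (rule fun_cong)

lemma op_fun_mult:
  fixes T :: "'a::chilbert_space \<Rightarrow> 'a"
  assumes T: "positive_op T" and h: "continuous_on {0..} h" and k: "continuous_on {0..} k"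
  shows "op_fun (\<lambda>t. h t * k t) T x = op_fun h T (op_fun k T x)"
  using functional_calculus_mult[OF is_functional_calculus_calc[OF positive_op_selfadjoint[OF T]]
      continuous_on_op_spectrum_of_real[OF T h] continuous_on_op_spectrum_of_real[OF T k]]
  unfolding op_fun_eq_calc[OF T h] op_fun_eq_calc[OF T k]
    op_fun_eq_calc[OF T continuous_on_mult[OF h k]] of_real_mult
  by (simp add: fun_eq_iff)

lemma op_fun_scale:
  fixes T :: "'a::chilbert_space \<Rightarrow> 'a"
  assumes T: "positive_op T" and h: "continuous_on {0..} h"
  shows "op_fun (\<lambda>t. c * h t) T x = complex_of_real c *\<^sub>C op_fun h T x"
  by (simp add: op_fun_mult[OF T continuous_on_const h] op_fun_const[OF T])

lemma selfadjoint_op_fun: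
  fixes T :: "'a::chilbert_space \<Rightarrow> 'a"
  assumes T: "positive_op T" and h: "continuous_on {0..} h"
  shows "selfadjoint (op_fun h T)"
proof -
  let ?h = "\<lambda>z. complex_of_real (h (Re z))"
  note C = is_functional_calculus_calc[OF positive_op_selfadjoint[OF T]]
  note h' = continuous_on_op_spectrum_of_real[OF T h]
  have bc: "bounded_clinear (calc T ?h)" by (rule functional_calculus_bounded_clinear[OF C h'])
  have "(calc T ?h)\<^sup>\<dagger> = calc T ?h"
    using functional_calculus_cnj[OF C h', symmetric] by (simp only: complex_cnj_complex_of_real)
  then have "cinner (calc T ?h x) y = cinner x (calc T ?h y)" for x y
    using cinner_cadjoint_left[OF bc, of x y] by (simp only:)
  then show ?thesis unfolding selfadjoint_def op_fun_eq_calc[OF T h] using bc by blast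
qed

lemma bounded_clinear_op_fun:
  fixes T :: "'a::chilbert_space \<Rightarrow> 'a"
  assumes "positive_op T" "continuous_on {0..} h"
  shows "bounded_clinear (op_fun h T)"
  by (rule selfadjoint_bounded_clinear[OF selfadjoint_op_fun[OF assms]])

lemma cinner_op_fun_mult_self:
  fixes T :: "'a::chilbert_space \<Rightarrow> 'a"
  assumes T: "positive_op T" and h: "continuous_on {0..} h"
  shows "cinner (op_fun (\<lambda>t. h t * h t) T x) x = of_real ((norm (op_fun h T x))\<^sup>2)"
  by (simp only: op_fun_mult[OF T h h] selfadjoint_cinner[OF selfadjoint_op_fun[OF T h]]
      flip: cinner_self)

text \<open>A nonnegative function is the square of its square root.\<close>

lemma op_fun_nonneg:
  fixes T :: "'a::chilbert_space \<Rightarrow> 'a"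
  assumes T: "positive_op T" and h: "continuous_on {0..} h" and nonneg: "\<And>t. t \<ge> 0 \<Longrightarrow> h t \<ge> 0"
  shows "0 \<le> Re (cinner (op_fun h T x) x)"
proof -
  have "op_fun h T = op_fun (\<lambda>t. sqrt (h t) * sqrt (h t)) T"
    by (rule op_fun_cong[OF T h]) (simp add: nonneg)
  then show ?thesis
    using cinner_op_fun_mult_self[OF T continuous_on_real_sqrt[OF h], of x] by simp
qed

lemma positive_op_op_fun:
  fixes T :: "'a::chilbert_space \<Rightarrow> 'a"
  assumes "positive_op T" "continuous_on {0..} h" "\<And>t. t \<ge> 0 \<Longrightarrow> h t \<ge> 0"
  shows "positive_op (op_fun h T)"
  unfolding positive_op_def
  using op_fun_nonneg[OF assms] selfadjoint_Im_cinner[OF selfadjoint_op_fun]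
    bounded_clinear_op_fun assms by blast

lemma op_fun_mono:
  fixes T :: "'a::chilbert_space \<Rightarrow> 'a"
  assumes T: "positive_op T" and h: "continuous_on {0..} h" and k: "continuous_on {0..} k"
    and le: "\<And>t. t \<ge> 0 \<Longrightarrow> h t \<le> k t"
  shows "Re (cinner (op_fun h T x) x) \<le> Re (cinner (op_fun k T x) x)"
proof -
  have d: "continuous_on {0..} (\<lambda>t. k t - h t)" by (intro continuous_intros h k)
  have "op_fun k T x = op_fun h T x + op_fun (\<lambda>t. k t - h t) T x"
    using op_fun_add[OF T h d, of x] by simp
  then show ?thesis
    using op_fun_nonneg[OF T d, of x] le by (simp add: cinner_add_left)
qed

section \<open>Square roots and absolute values\<close>

lemma positive_op_square:
  assumes R: "positive_op R"
  shows "positive_op (R \<circ> R)"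
proof -
  have "cinner (R (R x)) x = of_real ((norm (R x))\<^sup>2)" for x
    by (rule trans[OF selfadjoint_cinner[OF positive_op_selfadjoint[OF R]] cinner_self])
  then show ?thesis
    using R bounded_clinear_compose[of R R] by (simp add: positive_op_def comp_def)
qed

text \<open>\<open>R - z\<close> is a factor of \<open>R\<^sup>2 - z\<^sup>2\<close>, and the factors commute.  This is the inclusion that makes
  \<open>k(z\<^sup>2)\<close> continuous on the spectrum of \<open>R\<close> for \<open>k\<close> continuous on that of \<open>R\<^sup>2\<close>.\<close>

lemma op_spectrum_square:
  assumes R: "bounded_clinear R" and z: "z \<in> op_spectrum R"
  shows "z\<^sup>2 \<in> op_spectrum (R \<circ> R)"
proof (rule ccontr)
  let ?S = "\<lambda>x. R x - z *\<^sub>C x" and ?T = "\<lambda>x. R x + z *\<^sub>C x"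
  have ST: "?S (?T x) = R (R x) - z\<^sup>2 *\<^sub>C x" and TS: "?T (?S x) = R (R x) - z\<^sup>2 *\<^sub>C x" for x
    by (simp_all add: bounded_clinear_add[OF R] bounded_clinear_diff[OF R]
        bounded_clinear_scaleC[OF R] scaleC_add_right scaleC_diff_right scaleC_scaleC power2_eq_square)
  assume "z\<^sup>2 \<notin> op_spectrum (R \<circ> R)"
  then have "op_invertible (\<lambda>x. ?S (?T x))" by (simp add: op_spectrum_iff ST)
  then have "op_invertible ?S"
    by (rule op_invertible_left_factor)
      (simp_all only: ST TS, intro bounded_clinear_plus bounded_clinear_scale bounded_clinear_id R)
  then show False using z by (simp add: op_spectrum_iff)
qed

text \<open>
  Composing the functional calculus of \<open>R\<close> with squaring gives a functional calculus of \<open>R\<^sup>2\<close>, and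
  there is only one.
\<close>

lemma op_fun_square:
  fixes R :: "'a::chilbert_space \<Rightarrow> 'a"
  assumes R: "positive_op R" and h: "continuous_on {0..} h"
  shows "op_fun h (R \<circ> R) = op_fun (\<lambda>t. h (t\<^sup>2)) R"
proof -
  note R' = positive_op_selfadjoint[OF R]
  note C = is_functional_calculus_calc[OF R']
  let ?\<Psi> = "\<lambda>k. calc R (\<lambda>z. k (z\<^sup>2))"
  have sq: "continuous_on (op_spectrum R) (\<lambda>z. k (z\<^sup>2))"
    if "continuous_on (op_spectrum (R \<circ> R)) k" for k :: "complex \<Rightarrow> complex"
    by (rule continuous_on_compose2[OF that])
      (auto intro!: continuous_intros op_spectrum_square selfadjoint_bounded_clinear[OF R'])
  have ident: "?\<Psi> (\<lambda>z. z) = R \<circ> R"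
    using functional_calculus_mult[OF C continuous_on_id continuous_on_id]
    by (simp add: power2_eq_square functional_calculus_ident[OF C])
  have \<Psi>: "is_functional_calculus (R \<circ> R) ?\<Psi>"
    unfolding is_functional_calculus_def Let_def
  proof (intro conjI ballI allI impI)
    fix h k :: "complex \<Rightarrow> complex" assume "h \<in> {h. continuous_on (op_spectrum (R \<circ> R)) h}"
      "k \<in> {h. continuous_on (op_spectrum (R \<circ> R)) h}"
      and eq: "\<forall>z\<in>op_spectrum (R \<circ> R). h z = k z"
    then show "?\<Psi> h = ?\<Psi> k"
      by (intro calc_cong[OF R'] sq)
        (auto intro: op_spectrum_square selfadjoint_bounded_clinear[OF R'])
  qed (simp_all add: sq functional_calculus_scale[OF C],
      simp_all add: sq functional_calculus_bounded_clinear[OF C] functional_calculus_add[OF C]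
        functional_calculus_mult[OF C] functional_calculus_cnj[OF C] functional_calculus_one[OF C]
        ident)
  have h2: "continuous_on {0..} (\<lambda>t. h (t\<^sup>2))"
    by (rule continuous_on_compose2[OF h]) (auto intro!: continuous_intros)
  have "op_fun h (R \<circ> R) = calc R (\<lambda>z. complex_of_real (h (Re (z\<^sup>2))))"
    by (rule op_fun_eqI[OF positive_op_square[OF R] h \<Psi>])
  also have "\<dots> = calc R (\<lambda>z. complex_of_real (h ((Re z)\<^sup>2)))"
    by (intro calc_cong[OF R'] sq continuous_on_op_spectrum_of_real positive_op_square R h)
      (simp add: op_spectrum_selfadjoint_real[OF R'])
  also have "\<dots> = op_fun (\<lambda>t. h (t\<^sup>2)) R" by (simp add: op_fun_eq_calc[OF R h2])
  finally show ?thesis .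
qed

text \<open>A positive \<open>R\<close> is recovered from \<open>R\<^sup>2\<close>, which is the uniqueness of positive square roots.\<close>

lemma op_fun_sqrt_square:
  fixes R :: "'a::chilbert_space \<Rightarrow> 'a"
  assumes R: "positive_op R"
  shows "op_fun sqrt (R \<circ> R) = R"
proof -
  have c: "continuous_on {0..} sqrt" by (intro continuous_intros)
  have "op_fun sqrt (R \<circ> R) = op_fun (\<lambda>t. sqrt (t\<^sup>2)) R" by (rule op_fun_square[OF R c])
  also have "\<dots> = op_fun (\<lambda>t. t) R"
    by (rule op_fun_cong[OF R]) (auto intro!: continuous_intros)
  finally show ?thesis by (simp add: op_fun_ident[OF R])
qed

lemma op_sqrt_eq_op_fun:
  fixes T :: "'a::chilbert_space \<Rightarrow> 'a"
  assumes T: "positive_op T"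
  shows "op_sqrt T = op_fun sqrt T"
    and positive_op_op_sqrt: "positive_op (op_sqrt T)"
    and op_sqrt_square: "op_sqrt T \<circ> op_sqrt T = T"
proof -
  have c: "continuous_on {0..} sqrt" by (intro continuous_intros)
  have pos: "positive_op (op_fun sqrt T)" by (rule positive_op_op_fun[OF T c]) simp
  have "op_fun (\<lambda>t. sqrt t * sqrt t) T = op_fun (\<lambda>t. t) T"
    by (rule op_fun_cong[OF T]) (auto intro!: continuous_intros)
  then have "op_fun sqrt T (op_fun sqrt T x) = T x" for x
    using op_fun_mult[OF T c c, of x] by (simp only: op_fun_ident[OF T])
  then have sq: "op_fun sqrt T \<circ> op_fun sqrt T = T" by (simp add: fun_eq_iff)
  show eq: "op_sqrt T = op_fun sqrt T"
    unfolding op_sqrt_def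
  proof (rule the_equality)
    fix R assume R: "positive_op R \<and> R \<circ> R = T"
    then have "op_fun sqrt (R \<circ> R) = R" by (intro op_fun_sqrt_square) simp
    then show "R = op_fun sqrt T" using R by simp
  qed (use pos sq in simp)
  show "positive_op (op_sqrt T)" "op_sqrt T \<circ> op_sqrt T = T"
    using pos sq by (simp_all add: eq)
qed

lemma positive_op_cadjoint_compose:
  fixes X :: "'a::chilbert_space \<Rightarrow> 'b::chilbert_space"
  assumes X: "bounded_clinear X"
  shows "positive_op (X\<^sup>\<dagger> \<circ> X)"
  unfolding positive_op_def
  using bounded_clinear_compose[OF bounded_clinear_cadjoint[OF X] X]
  by (simp add: cinner_cadjoint_left[OF X] cinner_self comp_def)

lemma positive_op_op_abs:
  fixes X :: "'a::chilbert_space \<Rightarrow> 'b::chilbert_space"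
  assumes "bounded_clinear X"
  shows "positive_op (op_abs X)"
  unfolding op_abs_def by (intro positive_op_op_sqrt positive_op_cadjoint_compose assms)

lemma op_abs_square:
  fixes X :: "'a::chilbert_space \<Rightarrow> 'b::chilbert_space"
  assumes "bounded_clinear X"
  shows "op_abs X \<circ> op_abs X = X\<^sup>\<dagger> \<circ> X"
  unfolding op_abs_def by (intro op_sqrt_square positive_op_cadjoint_compose assms)

text \<open>Functions of \<open>\<bar>X\<bar>\<close> are functions of \<open>X\<^sup>* X\<close>; the latter is what \<open>X\<close> intertwines with \<open>X X\<^sup>*\<close>.\<close>

lemma op_fun_op_abs:
  fixes X :: "'a::chilbert_space \<Rightarrow> 'b::chilbert_space"
  assumes X: "bounded_clinear X" and h: "continuous_on {0..} h"
  shows "op_fun h (op_abs X) = op_fun (\<lambda>t. h (sqrt t)) (X\<^sup>\<dagger> \<circ> X)"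
proof -
  note P = positive_op_op_abs[OF X]
  have c: "continuous_on {0..} (\<lambda>t. h (sqrt t))"
    by (rule continuous_on_compose2[OF h]) (auto intro!: continuous_intros)
  have "op_fun (\<lambda>t. h (sqrt t)) (op_abs X \<circ> op_abs X) = op_fun (\<lambda>t. h (sqrt (t\<^sup>2))) (op_abs X)"
    by (rule op_fun_square[OF P c])
  also have "\<dots> = op_fun h (op_abs X)"
    by (rule op_fun_cong[OF P, symmetric]) (use h in auto)
  finally show ?thesis by (simp add: op_abs_square[OF X])
qed

text \<open>
  Intertwining passes from \<open>S\<close>, \<open>R\<close> to polynomials of them, and then to continuous functions, because
  one sequence of polynomials approximates \<open>h\<close> on both spectra.
\<close>

lemma op_fun_intertwine:
  fixes S :: "'a::chilbert_space \<Rightarrow> 'a" and R :: "'b::chilbert_space \<Rightarrow> 'b" and Z :: "'a \<Rightarrow> 'b"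
  assumes S: "positive_op S" and R: "positive_op R" and Z: "bounded_clinear Z"
    and inter: "\<And>x. Z (S x) = R (Z x)" and h: "continuous_on {0..} h"
  shows "Z (op_fun h S x) = op_fun h R (Z x)"
proof -
  note S' = positive_op_selfadjoint[OF S] and R' = positive_op_selfadjoint[OF R]
  note bS = selfadjoint_bounded_clinear[OF S'] and bR = selfadjoint_bounded_clinear[OF R']
  let ?K = "Re ` (op_spectrum S \<union> op_spectrum R)"
  let ?h = "\<lambda>z. complex_of_real (h (Re z))"
  have K: "compact ?K"
    by (intro compact_continuous_image compact_Un compact_op_spectrum bS bR continuous_intros)
  have "?K \<subseteq> {0..}" using op_spectrum_positive[OF S] op_spectrum_positive[OF R] by auto
  then have hK: "continuous_on ?K h" using h continuous_on_subset by blast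
  have "\<exists>q. \<forall>t\<in>?K. cmod (poly q (of_real t) - of_real (h t)) < inverse (real (Suc n))" for n
  proof -
    have "inverse (real (Suc n)) > 0" by simp
    then obtain q where
      "\<And>t. t \<in> ?K \<Longrightarrow> cmod (poly q (of_real t) - of_real (h t)) < inverse (real (Suc n))"
      by (rule exists_poly_approx_real[OF K hK]) iprover
    then show ?thesis by (intro exI ballI)
  qed
  then obtain q where q: "\<And>n. \<forall>t\<in>?K.
      cmod (poly (q n) (of_real t) - of_real (h t)) < inverse (real (Suc n))"
    using choice[of "\<lambda>n q. \<forall>t\<in>?K.
      cmod (poly q (of_real t) - of_real (h t)) < inverse (real (Suc n))"] by blast
  have lim: "uniform_limit \<sigma> (\<lambda>n. poly (q n)) ?h sequentially"
    if \<sigma>: "\<sigma> \<subseteq> op_spectrum S \<union> op_spectrum R" for \<sigma>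
  proof (rule uniform_limitI)
    fix e :: real assume "e > 0"
    then have "\<forall>\<^sub>F n in sequentially. inverse (real (Suc n)) < e"
      using LIMSEQ_inverse_real_of_nat order_tendstoD(2) by blast
    then show "\<forall>\<^sub>F n in sequentially. \<forall>z\<in>\<sigma>. dist (poly (q n) z) (?h z) < e"
    proof eventually_elim
      case (elim n)
      show ?case
      proof
        fix z assume "z \<in> \<sigma>"
        then have z: "z \<in> op_spectrum S \<union> op_spectrum R" using \<sigma> by blast
        then have real: "complex_of_real (Re z) = z"
          using op_spectrum_selfadjoint_of_real[OF S'] op_spectrum_selfadjoint_of_real[OF R'] by blast
        show "dist (poly (q n) z) (?h z) < e"
          using less_trans[OF bspec[OF q imageI[OF z]] elim] by (simp only: real dist_norm)
      qed
    qed
  qed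
  have pol: "Z (op_poly S p x) = op_poly R p (Z x)" for p x
    by (induction p)
      (simp_all add: op_poly_pCons[OF bS] op_poly_pCons[OF bR] bounded_clinear_add[OF Z]
        bounded_clinear_scaleC[OF Z] bounded_clinear_zero[OF Z] inter)
  have "(\<lambda>n. Z (op_poly S (q n) x)) \<longlonglongrightarrow> Z (calc S ?h x)"
    by (rule bounded_linear.tendsto[OF bounded_clinear_imp_bounded_linear[OF Z]
          calc_tendsto[OF S' lim]]) simp
  then have "(\<lambda>n. op_poly R (q n) (Z x)) \<longlonglongrightarrow> Z (calc S ?h x)" by (simp only: pol)
  moreover have "(\<lambda>n. op_poly R (q n) (Z x)) \<longlonglongrightarrow> calc R ?h (Z x)"
    by (rule calc_tendsto[OF R' lim]) simp
  ultimately have "Z (calc S ?h x) = calc R ?h (Z x)" by (rule LIMSEQ_unique)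
  then show ?thesis by (simp add: op_fun_eq_calc[OF S h] op_fun_eq_calc[OF R h])
qed

lemma op_fun_op_abs_intertwine:
  fixes X :: "'a::chilbert_space \<Rightarrow> 'b::chilbert_space"
  assumes X: "bounded_clinear X" and h: "continuous_on {0..} h"
  shows "X (op_fun h (op_abs X) x) = op_fun h (op_abs (X\<^sup>\<dagger>)) (X x)"
proof -
  note X' = bounded_clinear_cadjoint[OF X]
  have c: "continuous_on {0..} (\<lambda>t. h (sqrt t))"
    by (rule continuous_on_compose2[OF h]) (auto intro!: continuous_intros)
  show ?thesis
    unfolding op_fun_op_abs[OF X h] op_fun_op_abs[OF X' h]
    by (rule op_fun_intertwine[OF positive_op_cadjoint_compose[OF X]
          positive_op_cadjoint_compose[OF X'] X _ c])
      (simp add: cadjoint_cadjoint[OF X])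
qed

section \<open>The mixed Schwarz inequality\<close>

text \<open>
  For positive \<open>f\<close>, move the factor \<open>f(\<bar>X\<bar>)\<close> of the identity \<open>f(\<bar>X\<bar>) f(\<bar>X\<bar>)\<^sup>-\<^sup>1\<close> onto \<open>u\<close>; the remaining
  \<open>f(\<bar>X\<bar>)\<^sup>-\<^sup>1 X\<^sup>* v\<close> has the norm of \<open>h(\<bar>X\<^sup>*\<bar>) v\<close> with \<open>h(t) = t / f(t)\<close>, because \<open>X\<close> intertwines functions
  of \<open>\<bar>X\<bar>\<close> and \<open>\<bar>X\<^sup>*\<bar>\<close>.
\<close>

lemma mixed_schwarz_positive:
  fixes X :: "'a::chilbert_space \<Rightarrow> 'b::chilbert_space"
  assumes X: "bounded_clinear X" and f: "continuous_on {0..} f" and pos: "\<And>t. t \<ge> 0 \<Longrightarrow> f t > 0"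
  shows "cmod (cinner (X u) v) \<le>
    norm (op_fun f (op_abs X) u) * norm (op_fun (\<lambda>t. t / f t) (op_abs (X\<^sup>\<dagger>)) v)"
proof -
  note X' = bounded_clinear_cadjoint[OF X]
  let ?P = "op_abs X" and ?Q = "op_abs (X\<^sup>\<dagger>)"
  note P = positive_op_op_abs[OF X] and Q = positive_op_op_abs[OF X']
  let ?g = "\<lambda>t. 1 / f t" and ?h = "\<lambda>t. t / f t"
  have nz: "f t \<noteq> 0" if "t \<in> {0..}" for t using pos[of t] that by simp
  have g: "continuous_on {0..} ?g" by (intro continuous_intros f ballI nz)
  have h: "continuous_on {0..} ?h" by (intro continuous_intros f ballI nz)
  have gg: "continuous_on {0..} (\<lambda>t. ?g t * ?g t)" by (intro continuous_intros g)
  have t: "continuous_on {0..} (\<lambda>t::real. t)" by (intro continuous_intros)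
  let ?w = "op_fun ?g ?P ((X\<^sup>\<dagger>) v)"
  have "op_fun (\<lambda>t. ?g t * f t) ?P = op_fun (\<lambda>_. 1) ?P"
    by (rule op_fun_cong[OF P continuous_on_mult[OF g f]]) (use nz in simp)
  then have inv: "op_fun ?g ?P (op_fun f ?P u) = u"
    unfolding op_fun_mult[OF P g f, symmetric] by (simp add: op_fun_const[OF P] scaleC_one)
  have "cinner (X u) v = cinner (op_fun ?g ?P (op_fun f ?P u)) ((X\<^sup>\<dagger>) v)"
    unfolding inv by (rule cinner_cadjoint_right[OF X, symmetric])
  also have "\<dots> = cinner (op_fun f ?P u) ?w"
    by (rule selfadjoint_cinner[OF selfadjoint_op_fun[OF P g]])
  finally have "cmod (cinner (X u) v) \<le> norm (op_fun f ?P u) * norm ?w"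
    by (simp only: cmod_cinner_le)
  moreover have "norm ?w = norm (op_fun ?h ?Q v)"
  proof -
    let ?G = "op_fun (\<lambda>t. ?g t * ?g t) ?Q"
    have QQ: "?Q (?Q x) = X ((X\<^sup>\<dagger>) x)" for x
      using fun_cong[OF op_abs_square[OF X'], of x] by (simp add: cadjoint_cadjoint[OF X])
    have "complex_of_real ((norm ?w)\<^sup>2) =
        cinner (op_fun (\<lambda>t. ?g t * ?g t) ?P ((X\<^sup>\<dagger>) v)) ((X\<^sup>\<dagger>) v)"
      by (rule cinner_op_fun_mult_self[OF P g, symmetric])
    also have "\<dots> = cinner ((X\<^sup>\<dagger>) (?G v)) ((X\<^sup>\<dagger>) v)"
      using op_fun_op_abs_intertwine[OF X' gg, of v] by (simp only: cadjoint_cadjoint[OF X])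
    also have "\<dots> = cinner (?Q (?Q (?G v))) v"
      unfolding QQ by (rule cinner_cadjoint_right[OF X])
    also have "?Q (?Q (?G v)) = op_fun (\<lambda>t. t * (t * (?g t * ?g t))) ?Q v"
      by (simp only: op_fun_mult[OF Q t continuous_on_mult[OF t gg]] op_fun_mult[OF Q t gg]
          op_fun_ident[OF Q])
    also have "op_fun (\<lambda>t. t * (t * (?g t * ?g t))) ?Q = op_fun (\<lambda>t. ?h t * ?h t) ?Q"
      by (rule op_fun_cong[OF Q continuous_on_mult[OF t continuous_on_mult[OF t gg]]]) simp
    also have "cinner (op_fun (\<lambda>t. ?h t * ?h t) ?Q v) v = of_real ((norm (op_fun ?h ?Q v))\<^sup>2)"
      by (rule cinner_op_fun_mult_self[OF Q h])
    finally have "(norm ?w)\<^sup>2 = (norm (op_fun ?h ?Q v))\<^sup>2" by (simp only: of_real_eq_iff)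
    then show ?thesis by (rule power2_eq_imp_eq) auto
  qed
  ultimately show ?thesis by simp
qed

lemma norm_op_fun_mono:
  fixes T :: "'a::chilbert_space \<Rightarrow> 'a"
  assumes T: "positive_op T" and h: "continuous_on {0..} h" and k: "continuous_on {0..} k"
    and le: "\<And>t. t \<ge> 0 \<Longrightarrow> 0 \<le> h t \<and> h t \<le> k t"
  shows "norm (op_fun h T x) \<le> norm (op_fun k T x)"
proof -
  have "Re (cinner (op_fun (\<lambda>t. h t * h t) T x) x) \<le> Re (cinner (op_fun (\<lambda>t. k t * k t) T x) x)"
    by (intro op_fun_mono[OF T] continuous_on_mult h k mult_mono)
      (use le order_trans in blast)+
  then have "(norm (op_fun h T x))\<^sup>2 \<le> (norm (op_fun k T x))\<^sup>2"
    by (simp only: cinner_op_fun_mult_self[OF T h] cinner_op_fun_mult_self[OF T k]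
        Re_complex_of_real)
  then show ?thesis by (rule power2_le_imp_le) simp
qed

text \<open>
  Since \<open>f\<close> may vanish at \<open>0\<close>, the previous estimate is applied to \<open>f + \<epsilon>\<close>; then
  \<open>t / (f(t) + \<epsilon>) \<le> g(t)\<close>, and \<open>\<epsilon>\<close> tends to \<open>0\<close>.
\<close>

lemma mixed_schwarz:
  fixes X :: "'a::chilbert_space \<Rightarrow> 'b::chilbert_space"
  assumes X: "bounded_clinear X" and f: "continuous_on {0..} f" and g: "continuous_on {0..} g"
    and f0: "\<And>t. t \<ge> 0 \<Longrightarrow> f t \<ge> 0" and g0: "\<And>t. t \<ge> 0 \<Longrightarrow> g t \<ge> 0"
    and fg: "\<And>t. t \<ge> 0 \<Longrightarrow> f t * g t = t"
  shows "cmod (cinner (X u) v) \<le> norm (op_fun f (op_abs X) u) * norm (op_fun g (op_abs (X\<^sup>\<dagger>)) v)"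
proof (rule field_le_epsilon)
  note P = positive_op_op_abs[OF X] and Q = positive_op_op_abs[OF bounded_clinear_cadjoint[OF X]]
  let ?a = "norm (op_fun f (op_abs X) u)" and ?b = "norm (op_fun g (op_abs (X\<^sup>\<dagger>)) v)"
  fix e :: real assume "e > 0"
  then obtain d where d: "d > 0" "d * (norm u * ?b) < e"
    using exists_pos_mult_less[of e "norm u * ?b"] by auto
  have fd: "continuous_on {0..} (\<lambda>t. f t + d)" by (intro continuous_intros f)
  have pos: "f t + d > 0" if "t \<ge> 0" for t using f0[OF that] d(1) by simp
  have nz: "f t + d \<noteq> 0" if "t \<in> {0..}" for t using pos[of t] that by simp
  have "norm (op_fun (\<lambda>t. t / (f t + d)) (op_abs (X\<^sup>\<dagger>)) v) \<le> ?b"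
  proof (rule norm_op_fun_mono[OF Q _ g])
    show "continuous_on {0..} (\<lambda>t. t / (f t + d))" by (intro continuous_intros fd ballI nz)
    fix t :: real assume t: "t \<ge> 0"
    have "t \<le> g t * (f t + d)"
      using fg[OF t] mult_nonneg_nonneg[OF g0[OF t] less_imp_le[OF d(1)]]
      by (simp only: distrib_left mult.commute[of "g t" "f t"])
    then show "0 \<le> t / (f t + d) \<and> t / (f t + d) \<le> g t"
      using t pos[OF t] by (simp add: pos_divide_le_eq)
  qed
  moreover have "norm (op_fun (\<lambda>t. f t + d) (op_abs X) u) \<le> ?a + d * norm u"
    using norm_triangle_ineq[of "op_fun f (op_abs X) u" "complex_of_real d *\<^sub>C u"] d(1)
    by (simp add: op_fun_add[OF P f continuous_on_const] op_fun_const[OF P] norm_scaleC)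
  ultimately have "cmod (cinner (X u) v) \<le> (?a + d * norm u) * ?b"
    by (intro order_trans[OF mixed_schwarz_positive[OF X fd pos]] mult_mono) (use d in auto)
  then show "cmod (cinner (X u) v) \<le> ?a * ?b + e"
    using d(2) by (simp add: distrib_right mult.assoc)
qed

section \<open>Powers\<close>

text \<open>The tangent line of \<open>s \<mapsto> s\<^sup>p\<close> at \<open>a\<close> lies below the graph; for positive \<open>a\<close>, \<open>s\<close> this is Young's
  inequality for the product \<open>s a\<^sup>p\<^sup>-\<^sup>1\<close>.\<close>

lemma powr_tangent_le:
  fixes a s p :: real
  assumes a: "a \<ge> 0" and s: "s \<ge> 0" and p: "p \<ge> 1"
  shows "a powr p + p * a powr (p - 1) * (s - a) \<le> s powr p"
proof (cases "a = 0 \<or> s = 0")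
  case True
  have "a powr (p - 1) * a = a powr p"
    using powr_mult_base[OF a, of "p - 1"] by (simp add: mult.commute)
  then have "a powr p + p * a powr (p - 1) * (0 - a) = (1 - p) * a powr p"
    by (simp add: left_diff_distrib mult.assoc)
  also have "\<dots> \<le> 0" using p by (simp add: mult_nonpos_nonneg)
  finally show ?thesis using True by auto
next
  case False
  then have pos: "a > 0" "s > 0" using a s by auto
  have base: "a powr (p - 1) * a = a powr p"
    using powr_mult_base[OF a, of "p - 1"] by (simp add: mult.commute)
  have "(s powr p) powr (1 / p) * (a powr p) powr (1 - 1 / p) \<le> 1 / p * s powr p + (1 - 1 / p) * a powr p"
    by (rule Youngs_inequality_0) (use p pos in auto)
  moreover have "(s powr p) powr (1 / p) = s" using p pos by (simp add: powr_powr)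
  moreover have "(a powr p) powr (1 - 1 / p) = a powr (p - 1)"
    using p by (simp add: powr_powr right_diff_distrib)
  ultimately have "s * a powr (p - 1) \<le> 1 / p * s powr p + (1 - 1 / p) * a powr p" by simp
  then have "p * (s * a powr (p - 1)) \<le> p * (1 / p * s powr p + (1 - 1 / p) * a powr p)"
    using p by (intro mult_left_mono) auto
  also have "\<dots> = s powr p + (p - 1) * a powr p"
    using p by (simp add: distrib_left left_diff_distrib right_diff_distrib)
  finally have "p * (s * a powr (p - 1)) \<le> s powr p + (p - 1) * (a powr (p - 1) * a)"
    by (simp only: base)
  then show ?thesis unfolding base[symmetric] by (simp add: algebra_simps)
qed

text \<open>Adding the tangent inequalities at the midpoint \<open>m\<close>, the linear terms cancel.\<close>

lemma powr_add_le:
  fixes a b p :: real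
  assumes a: "a \<ge> 0" and b: "b \<ge> 0" and p: "p \<ge> 1"
  shows "(a + b) powr p \<le> 2 powr (p - 1) * (a powr p + b powr p)"
proof -
  define m where "m = (a + b) / 2"
  define c where "c = p * m powr (p - 1)"
  have ab: "2 * m = a + b" unfolding m_def mult_2 by (rule field_sum_of_halves)
  have m: "m \<ge> 0" using a b by (simp add: m_def)
  have "m powr p + c * (a - m) \<le> a powr p" "m powr p + c * (b - m) \<le> b powr p"
    unfolding c_def by (rule powr_tangent_le[OF m _ p], fact)+
  moreover have "c * (a - m) + c * (b - m) = 0"
  proof -
    have "(a - m) + (b - m) = 0" using ab by linarith
    then show ?thesis by (simp only: distrib_left[symmetric] mult_zero_right)
  qed
  ultimately have le: "2 * m powr p \<le> a powr p + b powr p" by linarith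
  have "(a + b) powr p = (2 * m) powr p" by (simp only: ab)
  also have "\<dots> = 2 powr (p - 1) * (2 * m powr p)"
  proof -
    have "2 * 2 powr (p - 1) = 2 powr p" using powr_mult_base[of 2 "p - 1"] by simp
    then show ?thesis unfolding powr_mult by (metis mult.assoc mult.commute)
  qed
  also have "\<dots> \<le> 2 powr (p - 1) * (a powr p + b powr p)" by (intro mult_left_mono le) simp
  finally show ?thesis .
qed

text \<open>
  Jensen's inequality for the spectral measure of \<open>u\<close>, proved by evaluating the tangent line of
  \<open>s \<mapsto> s\<^sup>p\<close> at \<open>a = \<langle>k(T) u, u\<rangle>\<close> on the operator \<open>k(T)\<close>.
\<close>

lemma powr_cinner_op_fun_le:
  fixes T :: "'a::chilbert_space \<Rightarrow> 'a"
  assumes T: "positive_op T" and k: "continuous_on {0..} k" and k0: "\<And>t. t \<ge> 0 \<Longrightarrow> k t \<ge> 0"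
    and p: "p \<ge> 1" and u: "norm u \<le> 1"
  shows "Re (cinner (op_fun k T u) u) powr p \<le> Re (cinner (op_fun (\<lambda>t. k t powr p) T u) u)"
proof -
  define a where "a = Re (cinner (op_fun k T u) u)"
  define c where "c = p * a powr (p - 1)"
  define b where "b = a powr p - c * a"
  have a: "a \<ge> 0" unfolding a_def by (rule op_fun_nonneg[OF T k k0])
  have ca: "c * a = p * a powr p"
    using powr_mult_base[OF a, of "p - 1"] by (simp add: c_def mult_ac)
  have ck: "continuous_on {0..} (\<lambda>t. c * k t)" by (intro continuous_intros k)
  have kp: "continuous_on {0..} (\<lambda>t. k t powr p)"
    by (rule continuous_on_powr'[OF k continuous_on_const]) (use k0 p in auto)
  have "Re (cinner (op_fun (\<lambda>t. b + c * k t) T u) u) \<le> Re (cinner (op_fun (\<lambda>t. k t powr p) T u) u)"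
  proof (rule op_fun_mono[OF T continuous_on_add[OF continuous_on_const ck] kp])
    fix t :: real assume "t \<ge> 0"
    then show "b + c * k t \<le> k t powr p"
      using powr_tangent_le[OF a k0[of t] p] by (simp add: b_def c_def right_diff_distrib)
  qed
  moreover have "Re (cinner (op_fun (\<lambda>t. b + c * k t) T u) u) = b * (norm u)\<^sup>2 + c * a"
    by (simp add: op_fun_add[OF T continuous_on_const ck] op_fun_const[OF T] op_fun_scale[OF T k]
        cinner_add_left cinner_scaleC_left cinner_self a_def del: of_real_power)
  moreover have "a powr p \<le> b * (norm u)\<^sup>2 + c * a"
  proof -
    have "b \<le> 0" using p by (simp add: b_def ca mult_right_mono[of 1 p "a powr p", simplified])
    moreover have "(norm u)\<^sup>2 \<le> 1" using u by (simp add: power_le_one)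
    ultimately have "b * 1 \<le> b * (norm u)\<^sup>2" by (intro mult_left_mono_neg)
    then show ?thesis by (simp add: b_def)
  qed
  ultimately show ?thesis by (simp add: a_def)
qed

lemma continuous_on_powr_twice:
  fixes f :: "real \<Rightarrow> real"
  assumes f: "continuous_on {0..} f" and f0: "\<And>t. t \<ge> 0 \<Longrightarrow> f t \<ge> 0" and p: "p \<ge> 1"
  shows "continuous_on {0..} (\<lambda>t. f t powr (2 * p))"
proof (rule continuous_on_powr'[OF f continuous_on_const])
  show "\<forall>t\<in>{0..}. 0 \<le> f t \<and> (f t = 0 \<longrightarrow> 0 < 2 * p)" using f0 p by simp
qed

text \<open>Jensen's inequality for \<open>k = f\<^sup>2\<close>, using \<open>\<parallel>f(T) u\<parallel>\<^sup>2 = \<langle>f\<^sup>2(T) u, u\<rangle>\<close>.\<close>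

lemma norm_op_fun_powr_le:
  fixes T :: "'a::chilbert_space \<Rightarrow> 'a"
  assumes T: "positive_op T" and f: "continuous_on {0..} f" and f0: "\<And>t. t \<ge> 0 \<Longrightarrow> f t \<ge> 0"
    and p: "p \<ge> 1" and u: "norm u \<le> 1"
  shows "norm (op_fun f T u) powr p \<le> sqrt (Re (cinner (op_fun (\<lambda>t. f t powr (2 * p)) T u) u))"
proof (rule real_le_rsqrt)
  let ?n = "norm (op_fun f T u)"
  have ff: "continuous_on {0..} (\<lambda>t. f t * f t)" by (intro continuous_intros f)
  note fp = continuous_on_powr_twice[OF f f0 p]
  have eq: "op_fun (\<lambda>t. (f t * f t) powr p) T = op_fun (\<lambda>t. f t powr (2 * p)) T"
    by (rule op_fun_cong[OF T fp, symmetric]) (simp_all only: powr_mult mult_2 powr_add)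
  have "(?n powr p)\<^sup>2 = (?n\<^sup>2) powr p" by (simp add: power2_eq_square powr_mult)
  also have "\<dots> = Re (cinner (op_fun (\<lambda>t. f t * f t) T u) u) powr p"
    unfolding cinner_op_fun_mult_self[OF T f] by (simp only: Re_complex_of_real)
  also have "\<dots> \<le> Re (cinner (op_fun (\<lambda>t. (f t * f t) powr p) T u) u)"
    by (rule powr_cinner_op_fun_le[OF T ff _ p u]) (use f0 in simp)
  finally show "(?n powr p)\<^sup>2 \<le> Re (cinner (op_fun (\<lambda>t. f t powr (2 * p)) T u) u)"
    unfolding eq .
qed

lemma mixed_schwarz_powr:
  fixes X :: "'a::chilbert_space \<Rightarrow> 'b::chilbert_space"
  assumes X: "bounded_clinear X" and f: "continuous_on {0..} f" and g: "continuous_on {0..} g"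
    and f0: "\<And>t. t \<ge> 0 \<Longrightarrow> f t \<ge> 0" and g0: "\<And>t. t \<ge> 0 \<Longrightarrow> g t \<ge> 0"
    and fg: "\<And>t. t \<ge> 0 \<Longrightarrow> f t * g t = t"
    and p: "p \<ge> 1" and u: "norm u \<le> 1" and v: "norm v \<le> 1"
  shows "cmod (cinner (X u) v) powr p \<le>
    sqrt (Re (cinner (op_fun (\<lambda>t. f t powr (2 * p)) (op_abs X) u) u)) *
    sqrt (Re (cinner (op_fun (\<lambda>t. g t powr (2 * p)) (op_abs (X\<^sup>\<dagger>)) v) v))"
proof -
  note P = positive_op_op_abs[OF X] and Q = positive_op_op_abs[OF bounded_clinear_cadjoint[OF X]]
  have "cmod (cinner (X u) v) powr p \<le>
      (norm (op_fun f (op_abs X) u) * norm (op_fun g (op_abs (X\<^sup>\<dagger>)) v)) powr p"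
    by (intro powr_mono2 mixed_schwarz X f g f0 g0 fg) (use p in auto)
  also have "\<dots> = norm (op_fun f (op_abs X) u) powr p * norm (op_fun g (op_abs (X\<^sup>\<dagger>)) v) powr p"
    by (rule powr_mult)
  also have "\<dots> \<le> sqrt (Re (cinner (op_fun (\<lambda>t. f t powr (2 * p)) (op_abs X) u) u)) *
      sqrt (Re (cinner (op_fun (\<lambda>t. g t powr (2 * p)) (op_abs (X\<^sup>\<dagger>)) v) v))"
    by (rule mult_mono'[OF norm_op_fun_powr_le[OF P f f0 p u] norm_op_fun_powr_le[OF Q g g0 p v]])
      simp_all
  finally show ?thesis .
qed

section \<open>Operator matrices and the generalized Euclidean operator radius\<close>

lemma contraction_bounded_clinear: "contraction T \<Longrightarrow> bounded_clinear T"
  by (simp add: contraction_def)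

lemma contraction_norm_le:
  fixes T :: "'a::chilbert_space \<Rightarrow> 'b::complex_inner"
  assumes "contraction T"
  shows "norm (T x) \<le> norm x"
proof -
  have "positive_op (\<lambda>x. id x - (T\<^sup>\<dagger> \<circ> T) x)"
    using assms unfolding contraction_def op_le_def by blast
  then have "0 \<le> Re (cinner (id x - (T\<^sup>\<dagger> \<circ> T) x) x)"
    unfolding positive_op_def by blast
  also have "cinner (id x - (T\<^sup>\<dagger> \<circ> T) x) x = of_real ((norm x)\<^sup>2 - (norm (T x))\<^sup>2)"
    unfolding id_apply comp_apply cinner_diff_left cinner_self of_real_diff
      cinner_cadjoint_left[OF contraction_bounded_clinear[OF assms]] ..
  finally have "(norm (T x))\<^sup>2 \<le> (norm x)\<^sup>2" by simp
  then show ?thesis by (rule power2_le_imp_le) simp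
qed

lemma bounded_clinear_op_matrix_diagonal:
  assumes A: "bounded_clinear A" and B: "bounded_clinear B"
  shows "bounded_clinear (op_matrix A (\<lambda>_. 0) (\<lambda>_. 0) B)"
proof -
  have eq: "op_matrix A (\<lambda>_. 0) (\<lambda>_. 0) B = (\<lambda>z. (A (fst z), B (snd z)))"
    by (auto simp: op_matrix_def)
  have "bounded_linear (\<lambda>z. (A (fst z), B (snd z)))"
    by (rule bounded_linear_Pair[OF
          bounded_linear_compose[OF bounded_clinear_imp_bounded_linear[OF A] bounded_linear_fst]
          bounded_linear_compose[OF bounded_clinear_imp_bounded_linear[OF B] bounded_linear_snd]])
  then show ?thesis
    unfolding eq bounded_clinear_def
    by (simp add: scaleC_prod_def bounded_clinear_scaleC[OF A] bounded_clinear_scaleC[OF B])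
qed

lemma bounded_clinear_conjugate:
  fixes V :: "'a::chilbert_space \<Rightarrow> 'b::chilbert_space"
  assumes V: "bounded_clinear V" and F: "bounded_clinear F"
  shows "bounded_clinear (\<lambda>x. (V\<^sup>\<dagger> \<circ> F \<circ> V) x)"
  unfolding comp_apply
  by (rule bounded_clinear_compose[OF bounded_clinear_cadjoint[OF V] bounded_clinear_compose[OF F V]])

lemma Re_cinner_le_onorm:
  assumes "bounded_clinear F"
  shows "Re (cinner (F x) x) \<le> onorm F * (norm x)\<^sup>2"
proof -
  have "Re (cinner (F x) x) \<le> norm (F x) * norm x" by (rule Re_cinner_le)
  also have "\<dots> \<le> (onorm F * norm x) * norm x"
    by (rule mult_right_mono[OF bounded_clinear_bound[OF assms] norm_ge_zero])
  finally show ?thesis by (simp add: power2_eq_square mult.assoc)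
qed

text \<open>The Cauchy-Schwarz inequality in the plane, for the vectors \<open>(\<surd>a, \<surd>d)\<close> and \<open>(\<surd>b, \<surd>c)\<close>.\<close>

lemma sqrt_mult_add_sqrt_mult_le:
  fixes a b c d :: real
  assumes "a \<ge> 0" "b \<ge> 0" "c \<ge> 0" "d \<ge> 0"
  shows "sqrt a * sqrt b + sqrt c * sqrt d \<le> sqrt (a + d) * sqrt (c + b)"
proof -
  have *: "(w * x + y * z)\<^sup>2 \<le> (w\<^sup>2 + z\<^sup>2) * (y\<^sup>2 + x\<^sup>2)" for w x y z :: real
  proof -
    have "(w\<^sup>2 + z\<^sup>2) * (y\<^sup>2 + x\<^sup>2) - (w * x + y * z)\<^sup>2 = (w * y - x * z)\<^sup>2"
      by (simp add: power2_eq_square algebra_simps)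
    then show ?thesis using zero_le_power2[of "w * y - x * z"] by linarith
  qed
  have "sqrt a * sqrt b + sqrt c * sqrt d \<le> sqrt ((a + d) * (c + b))"
    using *[of "sqrt a" "sqrt b" "sqrt c" "sqrt d"] assms by (intro real_le_rsqrt) simp
  then show ?thesis by (simp only: real_sqrt_mult)
qed

text \<open>
  The estimate for one summand.  The two off-diagonal corners are bounded by the mixed Schwarz
  inequality with the pairs \<open>(f, g)\<close> and \<open>(h, k)\<close>; the Cauchy-Schwarz inequality regroups the four
  quadratic forms into one in \<open>y\<close> and one in \<open>x\<close>, and \<open>\<parallel>x\<parallel> \<parallel>y\<parallel> \<le> 1/2\<close> turns \<open>2\<^sup>p\<^sup>-\<^sup>1\<close> into \<open>2\<^sup>p\<^sup>-\<^sup>2\<close>.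
\<close>

lemma off_diagonal_powr_le:
  fixes A C :: "'a::chilbert_space \<Rightarrow> 'a" and B D :: "'b::chilbert_space \<Rightarrow> 'b"
    and X :: "'b \<Rightarrow> 'a" and Y :: "'a \<Rightarrow> 'b"
  assumes A: "contraction A" and B: "contraction B" and C: "contraction C" and D: "contraction D"
    and X: "bounded_clinear X" and Y: "bounded_clinear Y"
    and f: "continuous_on {0..} f" "\<And>t. t \<ge> 0 \<Longrightarrow> f t \<ge> 0"
    and g: "continuous_on {0..} g" "\<And>t. t \<ge> 0 \<Longrightarrow> g t \<ge> 0"
    and h: "continuous_on {0..} h" "\<And>t. t \<ge> 0 \<Longrightarrow> h t \<ge> 0"
    and k: "continuous_on {0..} k" "\<And>t. t \<ge> 0 \<Longrightarrow> k t \<ge> 0"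
    and fg: "\<And>t. t \<ge> 0 \<Longrightarrow> f t * g t = t" and hk: "\<And>t. t \<ge> 0 \<Longrightarrow> h t * k t = t"
    and p: "p \<ge> 1" and xy: "(norm x)\<^sup>2 + (norm y)\<^sup>2 = 1"
  shows "cmod (cinner (X (D y)) (A x) + cinner (Y (C x)) (B y)) powr p \<le> 2 powr (p - 2) *
    (sqrt (onorm (\<lambda>x. (D\<^sup>\<dagger> \<circ> op_fun (\<lambda>t. f t powr (2 * p)) (op_abs X) \<circ> D) x +
       (B\<^sup>\<dagger> \<circ> op_fun (\<lambda>t. k t powr (2 * p)) (op_abs (Y\<^sup>\<dagger>)) \<circ> B) x)) *
     sqrt (onorm (\<lambda>x. (C\<^sup>\<dagger> \<circ> op_fun (\<lambda>t. h t powr (2 * p)) (op_abs Y) \<circ> C) x +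
       (A\<^sup>\<dagger> \<circ> op_fun (\<lambda>t. g t powr (2 * p)) (op_abs (X\<^sup>\<dagger>)) \<circ> A) x)))"
    (is "_ \<le> _ * (sqrt (onorm ?F) * sqrt (onorm ?G))")
proof -
  note PX = positive_op_op_abs[OF X] and QX = positive_op_op_abs[OF bounded_clinear_cadjoint[OF X]]
  note PY = positive_op_op_abs[OF Y] and QY = positive_op_op_abs[OF bounded_clinear_cadjoint[OF Y]]
  have "(norm x)\<^sup>2 \<le> 1\<^sup>2" "(norm y)\<^sup>2 \<le> 1\<^sup>2"
    unfolding one_power2
    using xy zero_le_power2[of "norm x"] zero_le_power2[of "norm y"] by linarith+
  then have x: "norm x \<le> 1" and y: "norm y \<le> 1"
    using power2_le_imp_le zero_le_one by blast+
  note small = order_trans[OF contraction_norm_le]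
  note cont = continuous_on_powr_twice[OF _ _ p]
  define a where "a = Re (cinner (op_fun (\<lambda>t. f t powr (2 * p)) (op_abs X) (D y)) (D y))"
  define b where "b = Re (cinner (op_fun (\<lambda>t. g t powr (2 * p)) (op_abs (X\<^sup>\<dagger>)) (A x)) (A x))"
  define c where "c = Re (cinner (op_fun (\<lambda>t. h t powr (2 * p)) (op_abs Y) (C x)) (C x))"
  define d where "d = Re (cinner (op_fun (\<lambda>t. k t powr (2 * p)) (op_abs (Y\<^sup>\<dagger>)) (B y)) (B y))"
  have a: "a \<ge> 0" unfolding a_def by (rule op_fun_nonneg[OF PX cont[OF f] powr_ge_zero])
  have b: "b \<ge> 0" unfolding b_def by (rule op_fun_nonneg[OF QX cont[OF g] powr_ge_zero])
  have c: "c \<ge> 0" unfolding c_def by (rule op_fun_nonneg[OF PY cont[OF h] powr_ge_zero])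
  have d: "d \<ge> 0" unfolding d_def by (rule op_fun_nonneg[OF QY cont[OF k] powr_ge_zero])
  have s1: "cmod (cinner (X (D y)) (A x)) powr p \<le> sqrt a * sqrt b"
    unfolding a_def b_def
    by (rule mixed_schwarz_powr[OF X f(1) g(1) f(2) g(2) fg p small[OF D y] small[OF A x]])
  have s2: "cmod (cinner (Y (C x)) (B y)) powr p \<le> sqrt c * sqrt d"
    unfolding c_def d_def
    by (rule mixed_schwarz_powr[OF Y h(1) k(1) h(2) k(2) hk p small[OF C x] small[OF B y]])
  note bcl = contraction_bounded_clinear[OF A] contraction_bounded_clinear[OF B]
    contraction_bounded_clinear[OF C] contraction_bounded_clinear[OF D]
  have F: "bounded_clinear ?F"
    by (rule bounded_clinear_plus[OF
          bounded_clinear_conjugate[OF bcl(4) bounded_clinear_op_fun[OF PX cont[OF f]]]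
          bounded_clinear_conjugate[OF bcl(2) bounded_clinear_op_fun[OF QY cont[OF k]]]])
  have G: "bounded_clinear ?G"
    by (rule bounded_clinear_plus[OF
          bounded_clinear_conjugate[OF bcl(3) bounded_clinear_op_fun[OF PY cont[OF h]]]
          bounded_clinear_conjugate[OF bcl(1) bounded_clinear_op_fun[OF QX cont[OF g]]]])
  have "a + d = Re (cinner (?F y) y)"
    by (simp add: a_def d_def cinner_add_left cinner_cadjoint_left bcl)
  also have "\<dots> \<le> onorm ?F * (norm y)\<^sup>2" by (rule Re_cinner_le_onorm[OF F])
  finally have ad: "sqrt (a + d) \<le> sqrt (onorm ?F) * norm y"
    using real_sqrt_le_mono[of "a + d" "onorm ?F * (norm y)\<^sup>2"]
    by (simp only: real_sqrt_mult real_sqrt_abs abs_norm_cancel)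
  have "c + b = Re (cinner (?G x) x)"
    by (simp add: b_def c_def cinner_add_left cinner_cadjoint_left bcl)
  also have "\<dots> \<le> onorm ?G * (norm x)\<^sup>2" by (rule Re_cinner_le_onorm[OF G])
  finally have cb: "sqrt (c + b) \<le> sqrt (onorm ?G) * norm x"
    using real_sqrt_le_mono[of "c + b" "onorm ?G * (norm x)\<^sup>2"]
    by (simp only: real_sqrt_mult real_sqrt_abs abs_norm_cancel)
  have "norm y * norm x \<le> 1 / 2"
    using sum_squares_bound[of "norm y" "norm x"] xy by simp
  then have half: "sqrt (onorm ?F) * sqrt (onorm ?G) * (norm y * norm x)
      \<le> sqrt (onorm ?F) * sqrt (onorm ?G) * (1 / 2)"
    by (intro mult_left_mono mult_nonneg_nonneg real_sqrt_ge_zero onorm_nonneg F G)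
  have "cmod (cinner (X (D y)) (A x) + cinner (Y (C x)) (B y)) powr p
      \<le> (cmod (cinner (X (D y)) (A x)) + cmod (cinner (Y (C x)) (B y))) powr p"
    by (intro powr_mono2 norm_triangle_ineq) (use p in auto)
  also have "\<dots> \<le> 2 powr (p - 1) *
      (cmod (cinner (X (D y)) (A x)) powr p + cmod (cinner (Y (C x)) (B y)) powr p)"
    by (rule powr_add_le[OF _ _ p]) auto
  also have "\<dots> \<le> 2 powr (p - 1) * (sqrt a * sqrt b + sqrt c * sqrt d)"
    by (rule mult_left_mono[OF add_mono[OF s1 s2] powr_ge_zero])
  also have "\<dots> \<le> 2 powr (p - 1) * (sqrt (a + d) * sqrt (c + b))"
    by (rule mult_left_mono[OF sqrt_mult_add_sqrt_mult_le[OF a b c d] powr_ge_zero])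
  also have "\<dots> \<le> 2 powr (p - 1) * ((sqrt (onorm ?F) * norm y) * (sqrt (onorm ?G) * norm x))"
    by (rule mult_left_mono[OF mult_mono'[OF ad cb real_sqrt_ge_zero[OF add_nonneg_nonneg[OF a d]]
            real_sqrt_ge_zero[OF add_nonneg_nonneg[OF c b]]] powr_ge_zero])
  also have "\<dots> = 2 powr (p - 1) * (sqrt (onorm ?F) * sqrt (onorm ?G) * (norm y * norm x))"
    by (simp only: mult_ac)
  also have "\<dots> \<le> 2 powr (p - 1) * (sqrt (onorm ?F) * sqrt (onorm ?G) * (1 / 2))"
    by (rule mult_left_mono[OF half powr_ge_zero])
  also have "\<dots> = 2 powr (p - 2) * (sqrt (onorm ?F) * sqrt (onorm ?G))"
    using powr_mult_base[of 2 "p - 2"] by simp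
  finally show ?thesis .
qed

lemma cinner_op_matrix_product:
  fixes A C :: "'a::chilbert_space \<Rightarrow> 'a" and B D :: "'b::chilbert_space \<Rightarrow> 'b"
    and X :: "'b \<Rightarrow> 'a" and Y :: "'a \<Rightarrow> 'b"
  assumes A: "bounded_clinear A" and B: "bounded_clinear B"
  shows "cinner (((op_matrix A (\<lambda>_. 0) (\<lambda>_. 0) B)\<^sup>\<dagger> \<circ> op_matrix (\<lambda>_. 0) X Y (\<lambda>_. 0) \<circ>
      op_matrix C (\<lambda>_. 0) (\<lambda>_. 0) D) z) z =
    cinner (X (D (snd z))) (A (fst z)) + cinner (Y (C (fst z))) (B (snd z))"
  by (simp add: cinner_cadjoint_left[OF bounded_clinear_op_matrix_diagonal[OF A B]])
    (simp add: op_matrix_def cinner_prod_def split: prod.split)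

lemma euclidean_operator_radius_powr_le:
  fixes T :: "nat \<Rightarrow> 'a::complex_inner \<Rightarrow> 'a"
  assumes p: "p \<ge> 1" and M: "M \<ge> 0"
    and le: "\<And>x. norm x = 1 \<Longrightarrow> (\<Sum>i=1..n. cmod (cinner (T i x) x) powr p) \<le> M"
  shows "euclidean_operator_radius p n T powr p \<le> M"
proof -
  let ?V = "insert 0 {(\<Sum>i=1..n. cmod (cinner (T i x) x) powr p) powr (1 / p) | x. norm x = 1}"
  have bound: "v \<le> M powr (1 / p)" if v: "v \<in> ?V" for v
  proof -
    consider "v = 0"
      | x where "norm x = 1" "v = (\<Sum>i=1..n. cmod (cinner (T i x) x) powr p) powr (1 / p)"
      using v by blast
    then show ?thesis
    proof cases
      case 2
      show ?thesis unfolding 2(2)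
        by (rule powr_mono2[OF _ sum_nonneg[OF powr_ge_zero] le[OF 2(1)]]) (use p in simp)
    qed simp
  qed
  have "0 \<le> Sup ?V" by (rule cSup_upper[OF insertI1 bdd_aboveI[OF bound]])
  moreover have "Sup ?V \<le> M powr (1 / p)" by (rule cSup_least[OF insert_not_empty bound])
  ultimately have "Sup ?V powr p \<le> (M powr (1 / p)) powr p"
    using p by (intro powr_mono2) auto
  also have "\<dots> = M" using p M by (simp add: powr_powr)
  finally show ?thesis by (simp only: euclidean_operator_radius_def)
qed

theorem theorem3p1:
  fixes A C :: "nat \<Rightarrow> 'a::chilbert_space \<Rightarrow> 'a"
    and B D :: "nat \<Rightarrow> 'b::chilbert_space \<Rightarrow> 'b"
    and X :: "nat \<Rightarrow> 'b \<Rightarrow> 'a"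
    and Y :: "nat \<Rightarrow> 'a \<Rightarrow> 'b"
    and S T U :: "nat \<Rightarrow> 'a \<times> 'b \<Rightarrow> 'a \<times> 'b"
    and f g :: "real \<Rightarrow> real"
    and p :: real
    and n :: nat
  assumes "n \<ge> 1"
    and "\<And>i. i \<in> {1..n} \<Longrightarrow> S i = op_matrix (A i) (\<lambda>_. 0) (\<lambda>_. 0) (B i)"
    and "\<And>i. i \<in> {1..n} \<Longrightarrow> T i = op_matrix (\<lambda>_. 0) (X i) (Y i) (\<lambda>_. 0)"
    and "\<And>i. i \<in> {1..n} \<Longrightarrow> U i = op_matrix (C i) (\<lambda>_. 0) (\<lambda>_. 0) (D i)"
    and "\<And>i. i \<in> {1..n} \<Longrightarrow> bounded_clinear (X i)"
    and "\<And>i. i \<in> {1..n} \<Longrightarrow> bounded_clinear (Y i)"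
    and "\<And>i. i \<in> {1..n} \<Longrightarrow> contraction (A i)"
    and "\<And>i. i \<in> {1..n} \<Longrightarrow> contraction (B i)"
    and "\<And>i. i \<in> {1..n} \<Longrightarrow> contraction (C i)"
    and "\<And>i. i \<in> {1..n} \<Longrightarrow> contraction (D i)"
    and "continuous_on {0..} f"
    and "continuous_on {0..} g"
    and "\<And>t. t \<ge> 0 \<Longrightarrow> f t \<ge> 0"
    and "\<And>t. t \<ge> 0 \<Longrightarrow> g t \<ge> 0"
    and "\<And>t. t \<ge> 0 \<Longrightarrow> f t * g t = t"
    and "p \<ge> 1"
  shows
    "(euclidean_operator_radius p n (\<lambda>i. (S i)\<^sup>\<dagger> \<circ> T i \<circ> U i)) powr p
       \<le> 2 powr (p - 2) * (\<Sum>i=1..n.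
           sqrt (onorm (\<lambda>x.
             ((D i)\<^sup>\<dagger> \<circ> op_fun (\<lambda>t. f t powr (2 * p)) (op_abs (X i)) \<circ> D i) x +
             ((B i)\<^sup>\<dagger> \<circ> op_fun (\<lambda>t. g t powr (2 * p)) (op_abs ((Y i)\<^sup>\<dagger>)) \<circ> B i) x)) *
           sqrt (onorm (\<lambda>x.
             ((C i)\<^sup>\<dagger> \<circ> op_fun (\<lambda>t. f t powr (2 * p)) (op_abs (Y i)) \<circ> C i) x +
             ((A i)\<^sup>\<dagger> \<circ> op_fun (\<lambda>t. g t powr (2 * p)) (op_abs ((X i)\<^sup>\<dagger>)) \<circ> A i) x))) \<and>
     (euclidean_operator_radius p n (\<lambda>i. (S i)\<^sup>\<dagger> \<circ> T i \<circ> U i)) powr p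
       \<le> 2 powr (p - 2) * (\<Sum>i=1..n.
           sqrt (onorm (\<lambda>x.
             ((D i)\<^sup>\<dagger> \<circ> op_fun (\<lambda>t. f t powr (2 * p)) (op_abs (X i)) \<circ> D i) x +
             ((B i)\<^sup>\<dagger> \<circ> op_fun (\<lambda>t. f t powr (2 * p)) (op_abs ((Y i)\<^sup>\<dagger>)) \<circ> B i) x)) *
           sqrt (onorm (\<lambda>x.
             ((C i)\<^sup>\<dagger> \<circ> op_fun (\<lambda>t. g t powr (2 * p)) (op_abs (Y i)) \<circ> C i) x +
             ((A i)\<^sup>\<dagger> \<circ> op_fun (\<lambda>t. g t powr (2 * p)) (op_abs ((X i)\<^sup>\<dagger>)) \<circ> A i) x)))"
proof -
  note S = assms(2) and T = assms(3) and U = assms(4) and X = assms(5) and Y = assms(6)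
    and A = assms(7) and B = assms(8) and C = assms(9) and D = assms(10)
    and f = assms(11,13) and g = assms(12,14) and fg = assms(15) and p = assms(16)
  have gf: "g t * f t = t" if "t \<ge> 0" for t using fg[OF that] by (simp only: mult.commute)
  note cont = continuous_on_powr_twice[OF _ _ p]
  \<comment> \<open>Both inequalities are the same estimate: only the pair used for \<open>Y\<close> changes, from \<open>(f, g)\<close> to
    \<open>(g, f)\<close>.\<close>
  have main: "euclidean_operator_radius p n (\<lambda>i. (S i)\<^sup>\<dagger> \<circ> T i \<circ> U i) powr p
       \<le> 2 powr (p - 2) * (\<Sum>i=1..n.
           sqrt (onorm (\<lambda>x.
             ((D i)\<^sup>\<dagger> \<circ> op_fun (\<lambda>t. f t powr (2 * p)) (op_abs (X i)) \<circ> D i) x +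
             ((B i)\<^sup>\<dagger> \<circ> op_fun (\<lambda>t. k t powr (2 * p)) (op_abs ((Y i)\<^sup>\<dagger>)) \<circ> B i) x)) *
           sqrt (onorm (\<lambda>x.
             ((C i)\<^sup>\<dagger> \<circ> op_fun (\<lambda>t. h t powr (2 * p)) (op_abs (Y i)) \<circ> C i) x +
             ((A i)\<^sup>\<dagger> \<circ> op_fun (\<lambda>t. g t powr (2 * p)) (op_abs ((X i)\<^sup>\<dagger>)) \<circ> A i) x)))"
    (is "_ \<le> _ * (\<Sum>i=1..n. sqrt (onorm (?F i)) * sqrt (onorm (?G i)))")
    if h: "continuous_on {0..} h" "\<And>t. t \<ge> 0 \<Longrightarrow> h t \<ge> 0"
      and k: "continuous_on {0..} k" "\<And>t. t \<ge> 0 \<Longrightarrow> k t \<ge> 0"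
      and hk: "\<And>t. t \<ge> 0 \<Longrightarrow> h t * k t = t" for h k
  proof (rule euclidean_operator_radius_powr_le[OF p])
    have nonneg: "0 \<le> sqrt (onorm (?F i)) * sqrt (onorm (?G i))" if i: "i \<in> {1..n}" for i
    proof -
      note PX = positive_op_op_abs[OF X[OF i]] and PY = positive_op_op_abs[OF Y[OF i]]
        and QX = positive_op_op_abs[OF bounded_clinear_cadjoint[OF X[OF i]]]
        and QY = positive_op_op_abs[OF bounded_clinear_cadjoint[OF Y[OF i]]]
        and bc = contraction_bounded_clinear[OF A[OF i]] contraction_bounded_clinear[OF B[OF i]]
          contraction_bounded_clinear[OF C[OF i]] contraction_bounded_clinear[OF D[OF i]]
      have "bounded_clinear (?F i)"
        by (rule bounded_clinear_plus[OF
              bounded_clinear_conjugate[OF bc(4) bounded_clinear_op_fun[OF PX cont[OF f]]]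
              bounded_clinear_conjugate[OF bc(2) bounded_clinear_op_fun[OF QY cont[OF k]]]])
      moreover have "bounded_clinear (?G i)"
        by (rule bounded_clinear_plus[OF
              bounded_clinear_conjugate[OF bc(3) bounded_clinear_op_fun[OF PY cont[OF h]]]
              bounded_clinear_conjugate[OF bc(1) bounded_clinear_op_fun[OF QX cont[OF g]]]])
      ultimately show ?thesis
        by (intro mult_nonneg_nonneg real_sqrt_ge_zero onorm_nonneg)
    qed
    show "0 \<le> 2 powr (p - 2) * (\<Sum>i=1..n. sqrt (onorm (?F i)) * sqrt (onorm (?G i)))"
      by (rule mult_nonneg_nonneg[OF powr_ge_zero sum_nonneg[OF nonneg]])
    fix z :: "'a \<times> 'b" assume z: "norm z = 1"
    have xy: "(norm (fst z))\<^sup>2 + (norm (snd z))\<^sup>2 = 1"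
      using z by (simp add: norm_prod_def)
    show "(\<Sum>i=1..n. cmod (cinner (((S i)\<^sup>\<dagger> \<circ> T i \<circ> U i) z) z) powr p)
        \<le> 2 powr (p - 2) * (\<Sum>i=1..n. sqrt (onorm (?F i)) * sqrt (onorm (?G i)))"
      unfolding sum_distrib_left
    proof (rule sum_mono)
      fix i assume i: "i \<in> {1..n}"
      show "cmod (cinner (((S i)\<^sup>\<dagger> \<circ> T i \<circ> U i) z) z) powr p
          \<le> 2 powr (p - 2) * (sqrt (onorm (?F i)) * sqrt (onorm (?G i)))"
        unfolding S[OF i] T[OF i] U[OF i] cinner_op_matrix_product[OF
            contraction_bounded_clinear[OF A[OF i]] contraction_bounded_clinear[OF B[OF i]]]
        by (rule off_diagonal_powr_le[OF A[OF i] B[OF i] C[OF i] D[OF i] X[OF i] Y[OF i]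
              f g h k fg hk p xy])
    qed
  qed
  show ?thesis by (rule conjI[OF main[OF f g fg] main[OF g f gf]])
qed

end
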